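(* If $G$ is a finite planar graph with girth at least $7$ and maximum degree $\Delta(G)$, then $ub(G)\le \lceil (\Delta(G)+1)/3\rceil+1$.
   Context: The girth of a graph is the length of its shortest cycle. A bar is a closed horizontal line segment of length $1$ in the plane. Two bars of an arrangement of pairwise disjoint bars see each other if there is an axis-parallel rectangle of positive width whose bottom side lies in one of them, whose top side lies in the other, and whose interior meets no bar of the arrangement. For a nonnegative integer $t$, a $t$-unit-bar visibility representation of a graph $G$ assigns to each vertex a set of at most $t$ bars, all bars pairwise disjoint, such that two distinct vertices are adjacent iff some bar of one sees some bar of the other; $ub(G)$ is the minimum such $t$. *)

theory Defs
  imports
    "HOL-Analysis.Analysis"
    "HOL-Library.Extended_Nat"
    "Graph_Theory.Pair_Digraph"
begin

text \<open>
  A finite simple graph is a \<^locale>\<open>pair_graph\<close>: every undirected edge is represented by its two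
  opposite arcs.  Hence the degree of a vertex is its out-degree.
\<close>

text \<open>Inserting 0 only matters for the graph without vertices.\<close>
definition max_degree :: "'a pair_pre_digraph \<Rightarrow> nat" where
  "max_degree G = Max (insert 0 ((\<lambda>v. out_degree (with_proj G) v) ` pverts G))"

text \<open>
  The library notion of a cycle admits going along an edge and back again, which is excluded by
  the bound on the length.  The girth of an acyclic graph is \<open>\<infinity>\<close>.
\<close>
definition girth :: "'a pair_pre_digraph \<Rightarrow> enat" where
  "girth G = Inf {enat (length p) | p. pre_digraph.cycle (with_proj G) p \<and> 3 \<le> length p}"

text \<open>
  Planarity is the existence of a drawing in the plane without crossings: vertices are distinct
  points, edges are simple arcs joining their endpoints, an edge passes through no other vertex,
  and two different edges meet in common endpoints only.  Curves are indexed by unordered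
  pairs, so that each undirected edge is drawn once.
\<close>
definition planar :: "'a pair_pre_digraph \<Rightarrow> bool" where
  "planar G \<longleftrightarrow> (\<exists>(\<phi> :: 'a \<Rightarrow> complex) (\<gamma> :: 'a set \<Rightarrow> real \<Rightarrow> complex).
     inj_on \<phi> (pverts G) \<and>
     (\<forall>(u, v) \<in> parcs G.
        arc (\<gamma> {u, v}) \<and>
        {pathstart (\<gamma> {u, v}), pathfinish (\<gamma> {u, v})} = {\<phi> u, \<phi> v} \<and>
        path_image (\<gamma> {u, v}) \<inter> \<phi> ` pverts G = {\<phi> u, \<phi> v}) \<and>
     (\<forall>(u, v) \<in> parcs G. \<forall>(x, y) \<in> parcs G. {u, v} \<noteq> {x, y} \<longrightarrow>
        path_image (\<gamma> {u, v}) \<inter> path_image (\<gamma> {x, y}) \<subseteq> \<phi> ` pverts G))"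

definition bar :: "(real \<times> real) set \<Rightarrow> bool" where
  "bar S \<longleftrightarrow> (\<exists>x y. S = {x..x + 1} \<times> {y})"

text \<open>\<open>sees \<A> S T\<close>: the bars \<open>S\<close> and \<open>T\<close> of the arrangement \<open>\<A>\<close> see each other.\<close>
definition sees ::
    "(real \<times> real) set set \<Rightarrow> (real \<times> real) set \<Rightarrow> (real \<times> real) set \<Rightarrow> bool" where
  "sees \<A> S T \<longleftrightarrow> (\<exists>a b c d. a < b \<and> c < d \<and>
     ({a..b} \<times> {c} \<subseteq> S \<and> {a..b} \<times> {d} \<subseteq> T \<or> {a..b} \<times> {c} \<subseteq> T \<and> {a..b} \<times> {d} \<subseteq> S) \<and>
     (\<forall>U \<in> \<A>. ({a<..<b} \<times> {c<..<d}) \<inter> U = {}))"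

text \<open>
  In the disjointness condition the bars carry their vertex as a label; since bars are nonempty,
  this also says that no bar is assigned to two vertices.
\<close>
definition unit_bar_representation ::
    "nat \<Rightarrow> 'a pair_pre_digraph \<Rightarrow> ('a \<Rightarrow> (real \<times> real) set set) \<Rightarrow> bool" where
  "unit_bar_representation t G B \<longleftrightarrow>
     (\<forall>v \<in> pverts G. finite (B v) \<and> card (B v) \<le> t \<and> (\<forall>S \<in> B v. bar S)) \<and>
     (\<forall>u \<in> pverts G. \<forall>v \<in> pverts G. \<forall>S \<in> B u. \<forall>T \<in> B v. (u, S) \<noteq> (v, T) \<longrightarrow> S \<inter> T = {}) \<and>
     (\<forall>u \<in> pverts G. \<forall>v \<in> pverts G. u \<noteq> v \<longrightarrow>
        ((u, v) \<in> parcs G \<longleftrightarrow>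
          (\<exists>S \<in> B u. \<exists>T \<in> B v. sees (\<Union>w \<in> pverts G. B w) S T)))"

definition ub :: "'a pair_pre_digraph \<Rightarrow> nat" where
  "ub G = (LEAST t. \<exists>B. unit_bar_representation t G B)"

end

theory Submission
  imports Defs
begin

text \<open>
  Suppose that the edges are oriented acyclically such that every vertex has at most 3 out-edges.
  Give a vertex one bar for each out-edge and let each of these bars also realise one in-edge; the
  remaining in-edges are collected in triples at further bars of the vertex.  A vertex with degree \<open>d\<close>
  and \<open>r\<close> out-edges then needs about \<open>(d + r) / 3\<close> bars, and the bars form disjoint spiders with at
  most three legs, which are easily laid out as stacks.

  The orientation exists since a triangle-free plane graph on \<open>n\<close> vertices has at most \<open>2 n - 2\<close> edges.
  This reduces to graphs without cut vertices.  There, a cycle of length \<open>l\<close> whose closed disc contains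
  \<open>v\<close> vertices and \<open>e\<close> edges satisfies \<open>4 v \<ge> 2 e + l + 4\<close>, by induction: an ear inside the cycle cuts the
  disc into two smaller ones.  Inverting the plane at a point inside a facial cycle moves the whole
  drawing into the disc of that cycle.
\<close>

section \<open>Paths as vertex lists\<close>

text \<open>The constants fit as follows. A vertex with r out-edges, i in-edges and c centres has r
  + c bars. If c > 0, then 3 c + r <= i + 2 together with r + i <= \<Delta> and r <= 3 gives 3 (r +
  c) <= \<Delta> + 5; if c = 0, there are r bars, where r <= 3 and r <= \<Delta>. In both cases
  there are at most \<Delta> div 3 + 2 bars, and the ceiling of (\<Delta> + 1) / 3 is \<Delta> div 3
  + 1. The bound 2 n - 2 is the one that survives the reduction: it holds for a single vertex or
  edge, where 2 n - 4 fails, and it is preserved when two graphs are glued at one vertex. It still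
  forces an average degree below 4, so every nonempty induced subgraph has a vertex of degree at
  most 3, and peeling off such vertices yields the orientation. The topological obstacle is the
  unbounded face: an estimate for discs of cycles ignores what lies outside, and no cycle around the
  whole drawing is at hand. A cycle with an empty disc is easy to find, by minimality, and the
  inversion exchanges the two sides of this cycle.\<close>

fun path_edges :: "'a list \<Rightarrow> 'a set set" where
  "path_edges (x # y # p) = insert {x, y} (path_edges (y # p))"
| "path_edges _ = {}"

lemma path_edges_Cons: "p \<noteq> [] \<Longrightarrow> path_edges (x # p) = insert {x, hd p} (path_edges p)"
  by (cases p) auto

lemma path_edges_snoc: "p \<noteq> [] \<Longrightarrow> path_edges (p @ [w]) = insert {last p, w} (path_edges p)"
  by (induction p rule: path_edges.induct) auto

lemma path_edges_append: "path_edges (p @ x # q) = path_edges (p @ [x]) \<union> path_edges (x # q)"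
  by (induction p rule: path_edges.induct) (auto simp: path_edges_Cons)

lemma path_edges_rev: "path_edges (rev p) = path_edges p"
proof (induction p rule: path_edges.induct)
  case (1 x y p)
  have "path_edges (rev (x # y # p)) = path_edges (rev p @ y # [x])" by simp
  also have "\<dots> = path_edges (rev (y # p)) \<union> {{y, x}}" by (subst path_edges_append) simp
  finally show ?case using 1 by auto
qed auto

lemma path_edges_subset: "e \<in> path_edges p \<Longrightarrow> e \<subseteq> set p"
  by (induction p rule: path_edges.induct) auto

lemma Union_path_edges: "2 \<le> length p \<Longrightarrow> \<Union> (path_edges p) = set p"
proof (induction p rule: path_edges.induct)
  case (1 x y p)
  then show ?case by (cases p) auto
qed auto

lemma finite_path_edges [simp]: "finite (path_edges p)"
  by (induction p rule: path_edges.induct) auto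

lemma card_path_edges_le: "card (path_edges p) \<le> length p - 1"
  by (induction p rule: path_edges.induct) (auto intro: order_trans[OF card_insert_le_m1] simp: card_insert_if)

lemma card_path_edges: "distinct p \<Longrightarrow> card (path_edges p) = length p - 1"
proof (induction p rule: path_edges.induct)
  case (1 x y p)
  then have "{x, y} \<notin> path_edges (y # p)"
    using path_edges_subset[of "{x, y}" "y # p"] by auto
  then show ?case using 1 by auto
qed auto

text \<open>Every edge of the path except the first misses \<open>u\<close>, and the first contains
  \<open>w\<close> only if \<open>xs\<close> is empty.\<close>

lemma path_edges_ends:
  assumes "distinct (u # xs @ [w])" "{u, w} \<in> path_edges (u # xs @ [w])"
  shows "xs = []"
proof (cases xs)
  case (Cons x ys)
  with assms have "{u, w} = {u, x} \<or> {u, w} \<in> path_edges (xs @ [w])" by auto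
  then show ?thesis
    using assms Cons path_edges_subset[of "{u, w}" "xs @ [w]"] by (auto simp: doubleton_eq_iff)
qed

text \<open>A common edge has its ends among the common vertices \<open>u\<close> and
  \<open>w\<close>, so it is \<open>{u, w}\<close>. A simple path from \<open>u\<close> to
  \<open>w\<close> with this edge has no inner vertex, and \<open>xs @ ys \<noteq> []\<close>
  prevents this for both paths at once.\<close>

lemma path_edges_disjoint:
  assumes "distinct (u # xs @ [w])" "distinct (u # ys @ [w])"
    and "set xs \<inter> set ys = {}" "xs @ ys \<noteq> []"
    and pair: "\<And>e. e \<in> path_edges (u # xs @ [w]) \<Longrightarrow> card e = 2"
  shows "path_edges (u # xs @ [w]) \<inter> path_edges (u # ys @ [w]) = {}"
proof (rule ccontr)
  assume "\<not> ?thesis"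
  then obtain e where e: "e \<in> path_edges (u # xs @ [w])" "e \<in> path_edges (u # ys @ [w])"
    by blast
  have "e \<subseteq> {u, w}"
    using path_edges_subset[OF e(1)] path_edges_subset[OF e(2)] assms(3) by auto
  moreover have "u \<noteq> w" using assms(1) by auto
  ultimately have "e = {u, w}" using pair[OF e(1)] by (intro card_subset_eq) auto
  with e path_edges_ends assms(1,2,4) show False by (metis append_Nil)
qed

section \<open>Inversion\<close>

text \<open>In the coordinate w = 1 / (x - z) the outside of \<open>K\<close>, completed by
  infinity, becomes a bounded open set \<open>U\<close>: a neighbourhood of infinity turns into one
  of 0, and a small disc about \<open>z\<close> inside \<open>K\<close> turns into a neighbourhood
  of infinity that \<open>U\<close> avoids. A component of the complement of the image that meets
  \<open>U\<close> cannot leave it, so it is bounded.\<close>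

lemma inversion_outside:
  fixes K :: "complex set"
  assumes "compact K" "z \<in> inside K"
  shows "(\<lambda>x. inverse (x - z)) ` outside K \<subseteq> inside ((\<lambda>x. inverse (x - z)) ` K)"
proof
  let ?f = "\<lambda>x. inverse (x - z)"
  fix x assume x: "x \<in> ?f ` outside K"
  define U where "U = {w. w = 0 \<or> z + inverse w \<in> outside K}"
  define W where "W = {w. w \<noteq> 0 \<and> z + inverse w \<in> inside K}"
  have K: "closed K" "bounded K" using assms compact_imp_closed compact_imp_bounded by auto
  have pre: "open {w. w \<noteq> 0 \<and> z + inverse w \<in> A}" if "open A" for A
  proof -
    have "open ((-{0}) \<inter> (\<lambda>w. z + inverse w) -` A)"
      using that by (intro continuous_open_preimage continuous_intros) auto
    then show ?thesis by (rule back_subst) auto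
  qed
  have opW: "open W" unfolding W_def using pre open_inside K by blast
  obtain B where B: "0 < B" "- outside K \<subseteq> ball z B"
    using cobounded_outside[OF K(2)] bounded_subset_ballD by blast
  \<comment> \<open>Points near 0 come from points far from \<open>z\<close>, all of which are
    outside \<open>K\<close>. This makes \<open>U\<close> open at 0, the image of infinity.\<close>
  have "U = ball 0 (inverse B) \<union> {w. w \<noteq> 0 \<and> z + inverse w \<in> outside K}"
  proof -
    have "z + inverse w \<in> outside K" if "w \<noteq> 0" "norm w < inverse B" for w
    proof -
      have "B < norm (inverse w)"
        using that B(1) by (simp add: norm_inverse) (metis inverse_inverse_eq less_imp_inverse_less zero_less_norm_iff)
      then have "z + inverse w \<notin> ball z B" by (simp add: dist_norm)
      then show ?thesis using B(2) by blast
    qed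
    then have "w \<in> U \<longleftrightarrow> w \<in> ball 0 (inverse B) \<union> {w. w \<noteq> 0 \<and> z + inverse w \<in> outside K}" for w
      using B(1) by (cases "w = 0") (auto simp: U_def)
    then show ?thesis by blast
  qed
  then have opU: "open U" using pre open_outside K(1) by auto
  obtain e where e: "0 < e" "ball z e \<subseteq> inside K"
    using open_inside[OF K(1)] assms(2) openE by blast
  have "norm w \<le> inverse e" if "w \<in> U" for w
  proof (cases "w = 0")
    case False
    then have "z + inverse w \<notin> ball z e"
      using that e(2) inside_Int_outside[of K] unfolding U_def by blast
    then have "e \<le> norm (inverse w)" by (simp add: dist_norm)
    then show ?thesis using e(1) False
      by (metis inverse_inverse_eq le_imp_inverse_le norm_inverse)
  qed (use e in simp)
  then have bU: "bounded U" using boundedI by blast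
  have UW: "U \<inter> W = {}" using inside_Int_outside[of K] unfolding U_def W_def by blast
  have cover: "- ?f ` K \<subseteq> U \<union> W"
  proof
    fix w assume w: "w \<in> - ?f ` K"
    show "w \<in> U \<union> W"
    proof (cases "w = 0")
      case False
      have "?f (z + inverse w) = w" by simp
      then have "z + inverse w \<notin> K" using w by (metis ComplD imageI)
      then have "z + inverse w \<in> inside K \<union> outside K" using inside_Un_outside by blast
      then show ?thesis using False unfolding U_def W_def by blast
    qed (simp add: U_def)
  qed
  obtain y where y: "y \<in> outside K" "x = ?f y" using x by blast
  have "y \<noteq> z" using y assms(2) inside_Int_outside[of K] by blast
  then have xU: "x \<in> U" using y by (simp add: U_def)
  have xK: "x \<notin> ?f ` K"
  proof -
    have "y \<notin> K" using y(1) outside_no_overlap[of K] by blast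
    then show ?thesis using y(2) by auto
  qed
  let ?C = "connected_component_set (- ?f ` K) x"
  have "?C \<subseteq> U"
  proof -
    have "?C \<subseteq> U \<union> W" using cover connected_component_subset by blast
    moreover have "x \<in> ?C \<inter> U" using xK xU by simp
    ultimately show ?thesis
      using connected_connected_component[of "- ?f ` K" x] opU opW UW unfolding connected_def by blast
  qed
  then have "bounded ?C" using bU bounded_subset by blast
  then show "x \<in> inside (?f ` K)" using xK by (simp add: inside_def)
qed

section \<open>Plane graphs and the discs of their cycles\<close>

text \<open>Edges are drawn as point sets without a direction. As \<open>{u, v} = {v, u}\<close>,
  the assumption \<open>edge_arc\<close> supplies a parametrisation from either end.\<close>

locale plane_graph =
  fixes V :: "'a set" and E :: "'a set set" and \<phi> :: "'a \<Rightarrow> complex" and \<Gamma> :: "'a set \<Rightarrow> complex set"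
  assumes finite_V: "finite V"
    and edge_ends: "e \<in> E \<Longrightarrow> \<exists>u\<in>V. \<exists>v\<in>V. u \<noteq> v \<and> e = {u, v}"
    and inj_\<phi>: "inj_on \<phi> V"
    and edge_arc: "{u, v} \<in> E \<Longrightarrow>
      \<exists>g. arc g \<and> path_image g = \<Gamma> {u, v} \<and> pathstart g = \<phi> u \<and> pathfinish g = \<phi> v"
    and edge_verts: "e \<in> E \<Longrightarrow> \<Gamma> e \<inter> \<phi> ` V = \<phi> ` e"
    and edges_meet: "e \<in> E \<Longrightarrow> f \<in> E \<Longrightarrow> e \<noteq> f \<Longrightarrow> \<Gamma> e \<inter> \<Gamma> f \<subseteq> \<phi> ` V"
begin

definition drawn :: "'a set set \<Rightarrow> complex set" where
  "drawn F = \<Union> (\<Gamma> ` F)"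

text \<open>For the edge set of a cycle this is the closed Jordan disc.\<close>

definition region :: "'a set set \<Rightarrow> complex set" where
  "region F = inside (drawn F) \<union> drawn F"

definition region_verts :: "'a set set \<Rightarrow> 'a set" where
  "region_verts F = {v \<in> V. \<phi> v \<in> region F}"

definition region_edges :: "'a set set \<Rightarrow> 'a set set" where
  "region_edges F = {e \<in> E. \<Gamma> e \<subseteq> region F}"

text \<open>Keeping only the two sets makes the starting point and the direction of the cycle
  irrelevant. The drawing does not enter, so a cycle remains one when the graph is drawn
  differently.\<close>

definition cyc :: "'a set \<Rightarrow> 'a set set \<Rightarrow> bool" where
  "cyc S F \<longleftrightarrow> (\<exists>u r. distinct (u # r) \<and> 2 \<le> length r \<and> S = set (u # r) \<and>
     F = path_edges (u # r @ [u]) \<and> F \<subseteq> E)"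

lemma finite_E: "finite E"
proof (rule finite_subset)
  show "E \<subseteq> Pow V" using edge_ends by fastforce
qed (simp add: finite_V)

lemma edge_subset: "e \<in> E \<Longrightarrow> e \<subseteq> V"
  using edge_ends by fastforce

lemma card_edge: "e \<in> E \<Longrightarrow> card e = 2"
  using edge_ends by fastforce

lemma drawn_Un: "drawn (F \<union> F') = drawn F \<union> drawn F'"
  by (auto simp: drawn_def)

text \<open>Different edges meet in vertices only, and a vertex on a drawn edge is one of its
  ends.\<close>

lemma drawn_Int:
  assumes "F \<subseteq> E" "F' \<subseteq> E" "F \<inter> F' = {}"
  shows "drawn F \<inter> drawn F' \<subseteq> \<phi> ` (\<Union>F \<inter> \<Union>F')"
proof
  fix z assume "z \<in> drawn F \<inter> drawn F'"
  then obtain e f where ef: "e \<in> F" "f \<in> F'" "z \<in> \<Gamma> e" "z \<in> \<Gamma> f" by (auto simp: drawn_def)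
  then have E: "e \<in> E" "f \<in> E" "e \<noteq> f" using assms by auto
  then have "z \<in> \<phi> ` V" using edges_meet ef by blast
  then have "z \<in> \<phi> ` e" "z \<in> \<phi> ` f" using edge_verts E ef by blast+
  then obtain x y where "x \<in> e" "y \<in> f" "z = \<phi> x" "z = \<phi> y" by auto
  moreover then have "x = y" using inj_\<phi> E edge_subset by (metis inj_on_def subsetD)
  ultimately show "z \<in> \<phi> ` (\<Union>F \<inter> \<Union>F')" using ef by auto
qed

lemma drawn_verts: "F \<subseteq> E \<Longrightarrow> drawn F \<inter> \<phi> ` V = \<phi> ` \<Union>F"
proof -
  assume "F \<subseteq> E"
  then have "(\<Union>e\<in>F. \<Gamma> e \<inter> \<phi> ` V) = (\<Union>e\<in>F. \<phi> ` e)"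
    by (intro SUP_cong refl edge_verts) auto
  then show ?thesis unfolding drawn_def by (simp add: image_Union Int_UN_distrib2 Int_commute)
qed

lemma vert_in_drawn: "F \<subseteq> E \<Longrightarrow> v \<in> V \<Longrightarrow> \<phi> v \<in> drawn F \<longleftrightarrow> v \<in> \<Union>F"
proof
  assume *: "F \<subseteq> E" "v \<in> V" "\<phi> v \<in> drawn F"
  then have "\<phi> v \<in> \<phi> ` \<Union>F" using drawn_verts by blast
  then obtain x where "x \<in> \<Union>F" "\<phi> x = \<phi> v" by force
  moreover have "x \<in> V" using calculation(1) * edge_subset by auto
  ultimately show "v \<in> \<Union>F" using * inj_\<phi> by (metis inj_onD)
next
  assume "F \<subseteq> E" "v \<in> \<Union>F"
  have "\<phi> v \<in> \<phi> ` \<Union>F" using \<open>v \<in> \<Union>F\<close> by (rule imageI)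
  then have "\<phi> v \<in> drawn F \<inter> \<phi> ` V" using drawn_verts[OF \<open>F \<subseteq> E\<close>] by simp
  then show "\<phi> v \<in> drawn F" ..
qed

text \<open>The arc of the first edge meets the drawing of the remaining path only in
  \<open>y\<close>, because \<open>x\<close> does not recur; hence joining the two gives an arc
  again.\<close>

lemma path_arc:
  assumes "distinct p" "2 \<le> length p" "path_edges p \<subseteq> E"
  shows "\<exists>g. arc g \<and> path_image g = drawn (path_edges p) \<and>
    pathstart g = \<phi> (hd p) \<and> pathfinish g = \<phi> (last p)"
  using assms
proof (induction p rule: path_edges.induct)
  case (1 x y p)
  obtain g where g: "arc g" "path_image g = \<Gamma> {x, y}" "pathstart g = \<phi> x" "pathfinish g = \<phi> y"
    using edge_arc[of x y] 1 by auto
  show ?case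
  proof (cases "p = []")
    case True
    with g show ?thesis by (auto simp: drawn_def)
  next
    case False
    then obtain h where h: "arc h" "path_image h = drawn (path_edges (y # p))"
      "pathstart h = \<phi> y" "pathfinish h = \<phi> (last (y # p))"
      using 1 by (cases p) auto
    have "{x, y} \<notin> path_edges (y # p)"
      using path_edges_subset[of "{x, y}" "y # p"] 1 by auto
    then have "drawn {{x, y}} \<inter> drawn (path_edges (y # p)) \<subseteq> \<phi> ` (\<Union>{{x, y}} \<inter> \<Union>(path_edges (y # p)))"
      using 1 by (intro drawn_Int) auto
    also have "\<dots> \<subseteq> {\<phi> y}" using 1 path_edges_subset[of _ "y # p"] by fastforce
    finally have "path_image g \<inter> path_image h \<subseteq> {pathstart h}"
      using g h by (simp add: drawn_def)
    then have "arc (g +++ h)" using g h by (intro arc_join) auto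
    moreover have "path_image (g +++ h) = drawn (path_edges (x # y # p))"
      using g h by (subst path_image_join) (auto simp: drawn_def)
    ultimately show ?thesis using g h False
      by (intro exI[of _ "g +++ h"]) auto
  qed
qed auto

lemma closed_edge: "e \<in> E \<Longrightarrow> closed (\<Gamma> e)"
  using edge_ends edge_arc by (metis arc_imp_path closed_path_image)

lemma closed_drawn: "F \<subseteq> E \<Longrightarrow> closed (drawn F)"
  unfolding drawn_def using closed_edge finite_E finite_subset
  by (intro closed_UN) auto

lemma compact_drawn: "F \<subseteq> E \<Longrightarrow> compact (drawn F)"
  unfolding drawn_def
proof (rule compact_UN)
  show "compact (\<Gamma> e)" if "F \<subseteq> E" "e \<in> F" for e
    using that edge_ends edge_arc by (metis compact_arc_image subsetD)
qed (use finite_E finite_subset in auto)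

text \<open>Removing its ends leaves an arc connected. A connected infinite set has no isolated
  points, so deleting two points does not change which points are limits.\<close>

lemma open_edge:
  assumes "e \<in> E"
  shows "connected (\<Gamma> e - \<phi> ` e)" "\<Gamma> e \<subseteq> closure (\<Gamma> e - \<phi> ` e)" "\<Gamma> e - \<phi> ` e \<noteq> {}"
proof -
  obtain u v where "e = {u, v}" using edge_ends assms by blast
  with edge_arc assms obtain g where g: "arc g" "path_image g = \<Gamma> e" "{pathstart g, pathfinish g} = \<phi> ` e"
    by (metis image_empty image_insert)
  then show "connected (\<Gamma> e - \<phi> ` e)" "\<Gamma> e - \<phi> ` e \<noteq> {}"
    using connected_simple_path_endless nonempty_simple_path_endless arc_imp_simple_path by metis+
  have con: "connected (\<Gamma> e)" using g connected_arc_image by metis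
  have ne: "pathstart g \<noteq> pathfinish g" using g arc_distinct_ends by metis
  have ends: "pathstart g \<in> \<Gamma> e" "pathfinish g \<in> \<Gamma> e" using g by auto
  then have inf: "infinite (\<Gamma> e)"
    using con ne connected_uncountable uncountable_infinite by metis
  show "\<Gamma> e \<subseteq> closure (\<Gamma> e - \<phi> ` e)"
  proof
    fix x assume x: "x \<in> \<Gamma> e"
    have "x islimpt \<Gamma> e"
      using con x inf by (metis connected_imp_perfect finite.emptyI finite_insert)
    then have "x islimpt (\<Gamma> e - \<phi> ` e)"
      by (metis Un_Diff_cancel2 g(3) finite.emptyI finite_insert islimpt_Un_finite sup_commute)
    then show "x \<in> closure (\<Gamma> e - \<phi> ` e)" by (simp add: closure_def)
  qed
qed

lemma open_edge_disjoint:
  assumes "e \<in> E" "F \<subseteq> E" "e \<notin> F"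
  shows "(\<Gamma> e - \<phi> ` e) \<inter> drawn F = {}"
proof -
  have False if "z \<in> \<Gamma> e" "z \<notin> \<phi> ` e" "f \<in> F" "z \<in> \<Gamma> f" for z f
  proof -
    have "f \<in> E" "e \<noteq> f" using that assms by auto
    then have "z \<in> \<phi> ` V" using edges_meet[OF assms(1)] that by blast
    then show False using edge_verts[OF assms(1)] that by blast
  qed
  then show ?thesis unfolding drawn_def by blast
qed

text \<open>An open edge that does not belong to \<open>F\<close> is connected and misses the
  drawing of \<open>F\<close>, so it cannot have points on both sides; its ends follow by taking
  closures.\<close>

lemma open_edge_in_inside:
  assumes "e \<in> E" "F \<subseteq> E" "e \<notin> F" "(\<Gamma> e - \<phi> ` e) \<inter> inside (drawn F) \<noteq> {}"
  shows "\<Gamma> e - \<phi> ` e \<subseteq> inside (drawn F)" "\<Gamma> e \<subseteq> region F"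
proof -
  have "(\<Gamma> e - \<phi> ` e) \<inter> outside (drawn F) = {}"
    using inside_outside_intersect_connected[OF open_edge(1)[OF assms(1)], of "drawn F"]
      open_edge_disjoint assms by blast
  then show *: "\<Gamma> e - \<phi> ` e \<subseteq> inside (drawn F)"
    using inside_Un_outside[of "drawn F"] open_edge_disjoint[OF assms(1-3)] by blast
  have "\<Gamma> e \<subseteq> closure (inside (drawn F))"
    using * open_edge(2)[OF assms(1)] closure_mono by blast
  then show "\<Gamma> e \<subseteq> region F"
    using closure_inside_subset[OF closed_drawn[OF assms(2)]] unfolding region_def by blast
qed

lemma region_edge_inside:
  assumes "F \<subseteq> E" "e \<in> region_edges F" "e \<notin> F"
  shows "\<Gamma> e - \<phi> ` e \<subseteq> inside (drawn F)"
proof -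
  have "e \<in> E" "\<Gamma> e \<subseteq> region F" using assms by (auto simp: region_edges_def)
  then show ?thesis using open_edge_disjoint[of e F] assms(1,3) unfolding region_def by blast
qed

lemma subset_region_edges: "F \<subseteq> E \<Longrightarrow> F \<subseteq> region_edges F"
  unfolding region_edges_def region_def drawn_def by (simp add: subset_iff) blast

lemma finite_region: "finite (region_verts F)" "finite (region_edges F)"
  using finite_V finite_E by (auto simp: region_verts_def region_edges_def)


section \<open>Cycles as pairs of paths, Jordan curves and theta graphs\<close>

lemma cyc_join:
  assumes "distinct (u # xs @ [w])" "distinct (u # ys @ [w])"
    and "set xs \<inter> set ys = {}" "xs @ ys \<noteq> []"
    and "path_edges (u # xs @ [w]) \<subseteq> E" "path_edges (u # ys @ [w]) \<subseteq> E"
  shows "cyc ({u, w} \<union> set xs \<union> set ys) (path_edges (u # xs @ [w]) \<union> path_edges (u # ys @ [w]))"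
proof -
  let ?r = "xs @ w # rev ys"
  have "path_edges (u # ?r @ [u]) = path_edges ((u # xs) @ w # rev ys @ [u])" by simp
  also have "\<dots> = path_edges (u # xs @ [w]) \<union> path_edges (rev (u # ys @ [w]))"
    by (subst path_edges_append) simp
  finally have eq: "path_edges (u # ?r @ [u]) = path_edges (u # xs @ [w]) \<union> path_edges (u # ys @ [w])"
    by (simp only: path_edges_rev)
  have "2 \<le> length ?r" using assms(4) by (cases xs; cases ys) auto
  moreover have "distinct (u # ?r)" using assms by auto
  moreover have "{u, w} \<union> set xs \<union> set ys = set (u # ?r)" by auto
  moreover have "path_edges (u # ?r @ [u]) \<subseteq> E" using assms eq by simp
  ultimately show ?thesis unfolding cyc_def eq[symmetric] by blast
qed

text \<open>The cycle is rotated so that it starts at \<open>u\<close> and is cut at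
  \<open>w\<close>. The second half is reversed, so that both paths run from \<open>u\<close> to
  \<open>w\<close> as in a theta graph.\<close>

lemma cyc_split:
  assumes "cyc S F" "u \<in> S" "w \<in> S" "u \<noteq> w"
  obtains xs ys where "distinct (u # xs @ [w])" "distinct (u # ys @ [w])"
    "set xs \<inter> set ys = {}" "xs @ ys \<noteq> []" "S = {u, w} \<union> set xs \<union> set ys"
    "F = path_edges (u # xs @ [w]) \<union> path_edges (u # ys @ [w])"
proof -
  obtain v r where r: "distinct (v # r)" "2 \<le> length r" "S = set (v # r)" "F = path_edges (v # r @ [v])"
    using assms(1) unfolding cyc_def by blast
  have "\<exists>q. distinct (u # q) \<and> 2 \<le> length q \<and> S = set (u # q) \<and> F = path_edges (u # q @ [u])"
  proof (cases "u = v")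
    case False
    then obtain as bs where s: "r = as @ u # bs" using assms(2) r(3) by (auto dest: split_list)
    have "F = path_edges ((v # as) @ u # bs @ [v])" using r(4) s by simp
    also have "\<dots> = path_edges (v # as @ [u]) \<union> path_edges (u # bs @ [v])"
      by (subst path_edges_append) simp
    also have "\<dots> = path_edges ((u # bs) @ [v]) \<union> path_edges (v # (as @ [u]))" by auto
    also have "\<dots> = path_edges (u # (bs @ v # as) @ [u])"
      by (subst path_edges_append[symmetric]) simp
    finally show ?thesis using r s by (intro exI[of _ "bs @ v # as"]) auto
  qed (use r in blast)
  then obtain q where q: "distinct (u # q)" "2 \<le> length q" "S = set (u # q)" "F = path_edges (u # q @ [u])"
    by blast
  then obtain xs ys where s: "q = xs @ w # ys" using assms(3,4) by (auto dest: split_list)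
  have "F = path_edges ((u # xs) @ w # ys @ [u])" using q(4) s by simp
  also have "\<dots> = path_edges (u # xs @ [w]) \<union> path_edges (rev (w # ys @ [u]))"
    by (subst path_edges_append) (simp add: path_edges_rev del: rev.simps)
  finally have "F = path_edges (u # xs @ [w]) \<union> path_edges (u # rev ys @ [w])" by simp
  with q s show ?thesis by (intro that[of xs "rev ys"]) auto
qed

lemma cyc_facts:
  assumes "cyc S F"
  shows "F \<subseteq> E" "S \<subseteq> V" "\<Union>F = S" "card F \<le> card S" "3 \<le> card S"
proof -
  obtain v r where r: "distinct (v # r)" "2 \<le> length r" "S = set (v # r)" "F = path_edges (v # r @ [v])" "F \<subseteq> E"
    using assms(1) unfolding cyc_def by blast
  show "F \<subseteq> E" by fact
  show U: "\<Union>F = S" unfolding r by (subst Union_path_edges) auto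
  then show "S \<subseteq> V" using r(5) edge_subset by blast
  have c: "card S = Suc (length r)" using r by (simp add: distinct_card)
  then show "3 \<le> card S" using r by simp
  show "card F \<le> card S" unfolding c unfolding r using card_path_edges_le[of "v # r @ [v]"] by simp
qed

lemma cyc_two: "cyc S F \<Longrightarrow> u \<in> S \<Longrightarrow> \<exists>w\<in>S. w \<noteq> u"
proof -
  assume "cyc S F" "u \<in> S"
  then have "\<not> S \<subseteq> {u}" using cyc_facts(5)[of S F] card_mono[of "{u}" S] by auto
  then show ?thesis by blast
qed

text \<open>Two paths between two vertices of the cycle are drawn as arcs with only their ends in
  common; reversing one of them closes the loop. This opens the way to the Jordan curve
  theorem.\<close>

lemma cyc_simple_path:
  assumes "cyc S F"
  shows "\<exists>g. simple_path g \<and> pathfinish g = pathstart g \<and> path_image g = drawn F"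
proof -
  have "S \<noteq> {}" using cyc_facts(5)[OF assms] by auto
  then obtain u where u: "u \<in> S" by blast
  obtain w where w: "w \<in> S" "w \<noteq> u" using cyc_two[OF assms u] by blast
  obtain xs ys where c: "distinct (u # xs @ [w])" "distinct (u # ys @ [w])"
    "set xs \<inter> set ys = {}" "xs @ ys \<noteq> []" "S = {u, w} \<union> set xs \<union> set ys"
    "F = path_edges (u # xs @ [w]) \<union> path_edges (u # ys @ [w])"
    using cyc_split[OF assms u w(1)] w(2) by metis
  let ?p = "u # xs @ [w]" and ?q = "u # ys @ [w]"
  have E: "path_edges ?p \<subseteq> E" "path_edges ?q \<subseteq> E" using c(6) cyc_facts(1)[OF assms] by auto
  obtain g where g: "arc g" "path_image g = drawn (path_edges ?p)" "pathstart g = \<phi> u" "pathfinish g = \<phi> w"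
    using path_arc[OF c(1) _ E(1)] by auto
  obtain h where h: "arc h" "path_image h = drawn (path_edges ?q)" "pathstart h = \<phi> u" "pathfinish h = \<phi> w"
    using path_arc[OF c(2) _ E(2)] by auto
  have "path_edges ?p \<inter> path_edges ?q = {}"
    using path_edges_disjoint[OF c(1-4)] card_edge E by blast
  from drawn_Int[OF E this] have "path_image g \<inter> path_image h \<subseteq> \<phi> ` (set ?p \<inter> set ?q)"
    unfolding g h by (subst (asm) (1 2) Union_path_edges) auto
  also have "\<dots> \<subseteq> {\<phi> u, \<phi> w}" using c(3) by auto
  finally have "simple_path (g +++ reversepath h)"
    using g h by (intro simple_path_join_loop) (auto simp: arc_reversepath)
  moreover have "path_image (g +++ reversepath h) = drawn F"
    using g h c(6) by (subst path_image_join) (auto simp: drawn_Un)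
  ultimately show ?thesis using g h by (intro exI[of _ "g +++ reversepath h"]) auto
qed

text \<open>The arc of \<open>F3\<close> is a crosscut: it has a point inside the closed curve and
  meets it only in its ends. It therefore splits the open disc into two open discs and the open
  crosscut. The two closed discs cover the old one and overlap exactly in the drawing of
  \<open>F3\<close>, so vertices and edges can be counted by inclusion and exclusion.\<close>

lemma theta:
  assumes d: "distinct (u # xs @ [w])" "distinct (u # ys @ [w])" "distinct (u # zs @ [w])"
    and dis: "set xs \<inter> set ys = {}" "set xs \<inter> set zs = {}" "set ys \<inter> set zs = {}"
    and ne: "xs @ ys \<noteq> []" "xs @ zs \<noteq> []" "ys @ zs \<noteq> []"
    and F: "F1 = path_edges (u # xs @ [w])" "F2 = path_edges (u # ys @ [w])" "F3 = path_edges (u # zs @ [w])"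
    and E: "F1 \<subseteq> E" "F2 \<subseteq> E" "F3 \<subseteq> E"
    and ins: "drawn F3 \<inter> inside (drawn (F1 \<union> F2)) \<noteq> {}"
  shows "region_edges (F1 \<union> F2) = region_edges (F1 \<union> F3) \<union> region_edges (F2 \<union> F3)"
    and "region_edges (F1 \<union> F3) \<inter> region_edges (F2 \<union> F3) = F3"
    and "region_verts (F1 \<union> F2) = region_verts (F1 \<union> F3) \<union> region_verts (F2 \<union> F3)"
    and "region_verts (F1 \<union> F3) \<inter> region_verts (F2 \<union> F3) = set (u # zs @ [w])"
proof -
  have U: "\<Union>F1 = set (u # xs @ [w])" "\<Union>F2 = set (u # ys @ [w])" "\<Union>F3 = set (u # zs @ [w])"
    unfolding F by (rule Union_path_edges, simp)+
  have uw: "u \<noteq> w" using d by auto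
  have "\<Union>F1 \<subseteq> V" using E(1) edge_subset by blast
  then have V: "u \<in> V" "w \<in> V" using U(1) by auto
  have pair: "card e = 2" if "e \<in> F1 \<or> e \<in> F2 \<or> e \<in> F3" for e using that E card_edge by blast
  have D: "F1 \<inter> F2 = {}" "F1 \<inter> F3 = {}" "F2 \<inter> F3 = {}"
    unfolding F by (rule path_edges_disjoint; use d dis ne pair in \<open>simp add: F\<close>)+
  obtain g1 where g1: "arc g1" "path_image g1 = drawn F1" "pathstart g1 = \<phi> u" "pathfinish g1 = \<phi> w"
    using path_arc[OF d(1)] E(1) F(1) by auto
  obtain g2 where g2: "arc g2" "path_image g2 = drawn F2" "pathstart g2 = \<phi> u" "pathfinish g2 = \<phi> w"
    using path_arc[OF d(2)] E(2) F(2) by auto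
  obtain g3 where g3: "arc g3" "path_image g3 = drawn F3" "pathstart g3 = \<phi> u" "pathfinish g3 = \<phi> w"
    using path_arc[OF d(3)] E(3) F(3) by auto
  have ends: "{\<phi> u, \<phi> w} \<subseteq> drawn F1" "{\<phi> u, \<phi> w} \<subseteq> drawn F2" "{\<phi> u, \<phi> w} \<subseteq> drawn F3"
    using g1 g2 g3 pathstart_in_path_image pathfinish_in_path_image by (metis empty_subsetI insert_subset)+
  have UU: "\<Union>F1 \<inter> \<Union>F2 \<subseteq> {u, w}" "\<Union>F1 \<inter> \<Union>F3 \<subseteq> {u, w}" "\<Union>F2 \<inter> \<Union>F3 \<subseteq> {u, w}"
    unfolding U using dis by auto
  have I12: "drawn F1 \<inter> drawn F2 = {\<phi> u, \<phi> w}"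
    using drawn_Int[OF E(1,2) D(1)] image_mono[OF UU(1), of \<phi>] ends by auto
  have I13: "drawn F1 \<inter> drawn F3 = {\<phi> u, \<phi> w}"
    using drawn_Int[OF E(1,3) D(2)] image_mono[OF UU(2), of \<phi>] ends by auto
  have I23: "drawn F2 \<inter> drawn F3 = {\<phi> u, \<phi> w}"
    using drawn_Int[OF E(2,3) D(3)] image_mono[OF UU(3), of \<phi>] ends by auto
  have uw\<phi>: "\<phi> u \<noteq> \<phi> w" using uw V inj_\<phi> by (auto dest: inj_onD)
  define J where "J = inside (drawn (F1 \<union> F2))"
  define J1 where "J1 = inside (drawn (F1 \<union> F3))"
  define J2 where "J2 = inside (drawn (F2 \<union> F3))"
  have J12: "J1 \<inter> J2 = {}" and JU: "J1 \<union> J2 \<union> (drawn F3 - {\<phi> u, \<phi> w}) = J"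
    using split_inside_simple_closed_curve[of g1 "\<phi> u" "\<phi> w" g2 g3] g1 g2 g3 arc_imp_simple_path
      uw\<phi> I12 I13 I23 ins unfolding J_def J1_def J2_def drawn_Un by metis+
  have out: "J \<inter> drawn F1 = {}" "J \<inter> drawn F2 = {}" "J1 \<inter> drawn F3 = {}" "J2 \<inter> drawn F3 = {}"
    using inside_no_overlap[of "drawn (F1 \<union> F2)"] inside_no_overlap[of "drawn (F1 \<union> F3)"]
      inside_no_overlap[of "drawn (F2 \<union> F3)"] unfolding J_def J1_def J2_def drawn_Un by blast+
  have R: "region (F1 \<union> F2) = J \<union> drawn F1 \<union> drawn F2" "region (F1 \<union> F3) = J1 \<union> drawn F1 \<union> drawn F3"
    "region (F2 \<union> F3) = J2 \<union> drawn F2 \<union> drawn F3"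
    unfolding region_def J_def J1_def J2_def drawn_Un by blast+
  have RU: "region (F1 \<union> F2) = region (F1 \<union> F3) \<union> region (F2 \<union> F3)"
    unfolding R using JU ends by blast
  have RI: "region (F1 \<union> F3) \<inter> region (F2 \<union> F3) = drawn F3"
    unfolding R using J12 out JU I12 ends by blast
  show "region_verts (F1 \<union> F2) = region_verts (F1 \<union> F3) \<union> region_verts (F2 \<union> F3)"
    unfolding region_verts_def RU by blast
  have "region_verts (F1 \<union> F3) \<inter> region_verts (F2 \<union> F3) = {v \<in> V. \<phi> v \<in> drawn F3}"
    unfolding region_verts_def RI[symmetric] by blast
  also have "\<dots> = \<Union>F3" using vert_in_drawn[OF E(3)] edge_subset E(3) by blast
  finally show "region_verts (F1 \<union> F3) \<inter> region_verts (F2 \<union> F3) = set (u # zs @ [w])"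
    unfolding U .
  have F3in: "e \<in> F3" if "e \<in> E" "\<Gamma> e \<subseteq> drawn F3" for e
    using open_edge_disjoint[OF that(1) E(3)] open_edge(3)[OF that(1)] that(2) by blast
  show "region_edges (F1 \<union> F3) \<inter> region_edges (F2 \<union> F3) = F3"
  proof
    show "region_edges (F1 \<union> F3) \<inter> region_edges (F2 \<union> F3) \<subseteq> F3"
    proof
      fix e assume "e \<in> region_edges (F1 \<union> F3) \<inter> region_edges (F2 \<union> F3)"
      then have "e \<in> E" "\<Gamma> e \<subseteq> drawn F3" unfolding region_edges_def RI[symmetric] by blast+
      then show "e \<in> F3" by (rule F3in)
    qed
    show "F3 \<subseteq> region_edges (F1 \<union> F3) \<inter> region_edges (F2 \<union> F3)"
      using subset_region_edges[of "F1 \<union> F3"] subset_region_edges[of "F2 \<union> F3"] E by blast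
  qed
  show "region_edges (F1 \<union> F2) = region_edges (F1 \<union> F3) \<union> region_edges (F2 \<union> F3)"
  proof
    show "region_edges (F1 \<union> F3) \<union> region_edges (F2 \<union> F3) \<subseteq> region_edges (F1 \<union> F2)"
      unfolding region_edges_def RU by blast
    show "region_edges (F1 \<union> F2) \<subseteq> region_edges (F1 \<union> F3) \<union> region_edges (F2 \<union> F3)"
    proof
      fix e assume e: "e \<in> region_edges (F1 \<union> F2)"
      have eE: "e \<in> E" using e by (simp add: region_edges_def)
      show "e \<in> region_edges (F1 \<union> F3) \<union> region_edges (F2 \<union> F3)"
      proof (cases "e \<in> F1 \<union> F2 \<union> F3")
        case True
        then show ?thesis
          using subset_region_edges[of "F1 \<union> F3"] subset_region_edges[of "F2 \<union> F3"] E by blast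
      next
        case False
        have "\<Gamma> e - \<phi> ` e \<subseteq> J"
          unfolding J_def using region_edge_inside[OF _ e] False E by blast
        moreover have "(\<Gamma> e - \<phi> ` e) \<inter> drawn F3 = {}"
          using open_edge_disjoint[OF eE E(3)] False by blast
        \<comment> \<open>The open edge is nonempty and avoids the crosscut, so it has a point in
          one of the two open discs and then lies in that disc entirely.\<close>
        ultimately have "(\<Gamma> e - \<phi> ` e) \<inter> J1 \<noteq> {} \<or> (\<Gamma> e - \<phi> ` e) \<inter> J2 \<noteq> {}"
          using open_edge(3)[OF eE] JU by blast
        then have "\<Gamma> e \<subseteq> region (F1 \<union> F3) \<or> \<Gamma> e \<subseteq> region (F2 \<union> F3)"
          using open_edge_in_inside(2)[OF eE, of "F1 \<union> F3"] open_edge_in_inside(2)[OF eE, of "F2 \<union> F3"]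
            False E unfolding J1_def J2_def by blast
        then show ?thesis using eE by (auto simp: region_edges_def)
      qed
    qed
  qed
qed


section \<open>Connectivity through paths and through cuts\<close>

definition reach :: "'a set \<Rightarrow> 'a \<Rightarrow> 'a set" where
  "reach T v = {x. \<exists>p. distinct p \<and> p \<noteq> [] \<and> hd p = v \<and> last p = x \<and> set p \<subseteq> T \<and> path_edges p \<subseteq> E}"

lemma reach_subset: "reach T v \<subseteq> T"
  by (auto simp: reach_def)

lemma reach_self: "v \<in> T \<Longrightarrow> v \<in> reach T v"
  unfolding reach_def by (auto intro: exI[of _ "[v]"])

lemma reach_step:
  assumes "x \<in> reach T v" "{x, y} \<in> E" "y \<in> T"
  shows "y \<in> reach T v"
proof -
  obtain p where p: "distinct p" "p \<noteq> []" "hd p = v" "last p = x" "set p \<subseteq> T" "path_edges p \<subseteq> E"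
    using assms(1) by (auto simp: reach_def)
  show ?thesis
  proof (cases "y \<in> set p")
    case True
    \<comment> \<open>A path that already visits \<open>y\<close> is cut off there, which keeps its
      vertices distinct.\<close>
    then obtain as bs where s: "p = as @ y # bs" by (auto dest: split_list)
    have "path_edges (as @ [y]) \<subseteq> E" using p(6) unfolding s by (subst (asm) path_edges_append) simp
    moreover have "hd (as @ [y]) = v" using p(3) s by (cases as) auto
    ultimately show ?thesis using p s unfolding reach_def by (auto intro!: exI[of _ "as @ [y]"])
  next
    case False
    then show ?thesis using p assms unfolding reach_def
      by (auto intro!: exI[of _ "p @ [y]"] simp: path_edges_snoc)
  qed
qed

text \<open>Connectivity in terms of cuts: its negation directly delivers the two sides of a
  separation, as needed for gluing. Where a path is required, \<open>reach\<close> produces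
  it.\<close>

definition conn :: "'a set \<Rightarrow> bool" where
  "conn X \<longleftrightarrow> (\<forall>A\<subseteq>X. A \<noteq> {} \<longrightarrow> A \<noteq> X \<longrightarrow> (\<exists>a\<in>A. \<exists>b\<in>X - A. {a, b} \<in> E))"

lemma conn_cross:
  assumes "conn X" "A \<subseteq> X" "A \<noteq> {}" "A \<noteq> X"
  obtains a b where "a \<in> A" "b \<in> X" "b \<notin> A" "{a, b} \<in> E"
  using assms unfolding conn_def by blast

end

section \<open>Ears and the count in the disc of a cycle\<close>

locale biconnected_triangle_free_plane_graph = plane_graph +
  assumes conn_V: "conn V"
    and conn_minus: "u \<in> V \<Longrightarrow> conn (V - {u})"
    and triangle_free: "{a, b} \<in> E \<Longrightarrow> {b, c} \<in> E \<Longrightarrow> {c, a} \<in> E \<Longrightarrow> False"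
begin

lemma card_cyc:
  assumes "cyc S F"
  shows "4 \<le> card S"
proof (rule ccontr)
  obtain v r where r: "distinct (v # r)" "2 \<le> length r" "S = set (v # r)" "F = path_edges (v # r @ [v])" "F \<subseteq> E"
    using assms(1) unfolding cyc_def by blast
  assume "\<not> 4 \<le> card S"
  then have "length r = 2" using r by (simp add: distinct_card)
  then obtain a b where "r = [a, b]" by (auto simp: length_Suc_conv numeral_2_eq_2)
  then show False using r triangle_free[of v a b] by auto
qed

text \<open>If no such edge existed, anything additional in the disc would put a vertex strictly
  inside. By connectivity some edge leaves the set \<open>A\<close> of these vertices. Starting
  inside, it stays in the closed disc, so its other end is on the cycle: this is the desired edge
  after all.\<close>

lemma edge_into_region:
  assumes c: "cyc S F" and nf: "region_edges F \<noteq> F \<or> region_verts F \<noteq> S"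
  shows "\<exists>u v. u \<in> S \<and> {u, v} \<in> region_edges F \<and> {u, v} \<notin> F"
proof (rule ccontr)
  assume no: "\<not> ?thesis"
  note cf = cyc_facts[OF c]
  define A where "A = {x \<in> V. \<phi> x \<in> inside (drawn F)}"
  have inA: "x \<in> A" if "x \<in> V" "x \<notin> S" "\<phi> x \<in> region F" for x
    using that vert_in_drawn[OF cf(1), of x] cf(3) by (auto simp: A_def region_def)
  have AS: "A \<inter> S = {}"
  proof -
    have "\<phi> x \<in> drawn F" if "x \<in> S" for x using that vert_in_drawn[OF cf(1)] cf(2,3) by blast
    then show ?thesis using inside_no_overlap[of "drawn F"] unfolding A_def by blast
  qed
  have "A \<noteq> {}"
  proof (cases "region_edges F = F")
    case False
    then obtain e where e: "e \<in> region_edges F" "e \<notin> F" using subset_region_edges[OF cf(1)] by blast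
    then have "e \<in> E" "\<Gamma> e \<subseteq> region F" by (auto simp: region_edges_def)
    then obtain a b where ab: "a \<in> V" "e = {a, b}" using edge_ends by blast
    have "a \<notin> S" using no e ab by blast
    moreover have "\<phi> a \<in> \<Gamma> e" using edge_verts[OF \<open>e \<in> E\<close>] ab by blast
    ultimately show ?thesis using inA ab \<open>\<Gamma> e \<subseteq> region F\<close> by blast
  next
    case True
    have "S \<subseteq> region_verts F"
      using vert_in_drawn[OF cf(1)] cf(2,3) by (auto simp: region_verts_def region_def)
    then obtain x where "x \<in> region_verts F" "x \<notin> S" using nf True by blast
    then show ?thesis using inA by (auto simp: region_verts_def)
  qed
  moreover have "S \<noteq> {}" using cf(5) by auto
  then have "A \<noteq> V" using AS cf(2) by blast
  ultimately obtain x y where xy: "x \<in> A" "y \<in> V" "y \<notin> A" "{x, y} \<in> E"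
    using conn_cross[OF conn_V, of A] by (auto simp: A_def)
  have nF: "{x, y} \<notin> F" using xy(1) AS cf(3) by blast
  have "\<phi> x \<in> \<Gamma> {x, y}" using edge_verts[OF xy(4)] by blast
  \<comment> \<open>The open edge accumulates at its end, which lies in an open set; hence it has
    points inside as well.\<close>
  then have "\<phi> x \<in> closure (\<Gamma> {x, y} - \<phi> ` {x, y})" using open_edge(2)[OF xy(4)] by blast
  then have "(\<Gamma> {x, y} - \<phi> ` {x, y}) \<inter> inside (drawn F) \<noteq> {}"
    using xy(1) open_Int_closure_eq_empty[OF open_inside[OF closed_drawn[OF cf(1)]]]
    by (auto simp: A_def)
  then have sub: "\<Gamma> {x, y} \<subseteq> region F"
    using open_edge_in_inside(2)[OF xy(4) cf(1) nF] by blast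
  have "\<phi> y \<in> \<Gamma> {x, y}" using edge_verts[OF xy(4)] by blast
  then have "y \<in> S" using inA xy sub by blast
  moreover have "{y, x} \<in> region_edges F" "{y, x} \<notin> F"
    using sub xy(4) nF by (auto simp: region_edges_def insert_commute)
  ultimately show False using no by blast
qed

text \<open>Having entered the disc along an edge \<open>{u, v}\<close> with \<open>v\<close> off
  the cycle, walk on within \<open>V - S\<close>. As \<open>V - {u}\<close> is connected, an edge
  leaves the set reached and avoids \<open>u\<close>; it can only lead to the cycle. One edge
  \<open>e\<close> known to lie in the disc is enough for \<open>theta\<close>, since the ear meets
  the cycle only in its ends.\<close>

lemma ear:
  assumes c: "cyc S F" and nf: "region_edges F \<noteq> F \<or> region_verts F \<noteq> S"
  obtains u w zs e where "u \<in> S" "w \<in> S" "u \<noteq> w" "distinct (u # zs @ [w])" "set zs \<inter> S = {}"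
    "path_edges (u # zs @ [w]) \<subseteq> E" "e \<in> path_edges (u # zs @ [w])" "e \<in> region_edges F" "e \<notin> F"
proof -
  note cf = cyc_facts[OF c]
  obtain u v where uv: "u \<in> S" "{u, v} \<in> region_edges F" "{u, v} \<notin> F"
    using edge_into_region[OF assms] by blast
  have uvE: "{u, v} \<in> E" using uv by (simp add: region_edges_def)
  then have "u \<noteq> v" using card_edge by fastforce
  show ?thesis
  proof (cases "v \<in> S")
    case True
    then show ?thesis using that[of u v "[]" "{u, v}"] uv uvE \<open>u \<noteq> v\<close> by auto
  next
    case False
    have v: "v \<in> V - S" using uvE edge_subset False by blast
    let ?R = "reach (V - S) v"
    have R: "?R \<subseteq> V - S" by (rule reach_subset)
    obtain w' where "w' \<in> S" "w' \<noteq> u" using cyc_two[OF c uv(1)] by blast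
    then have "?R \<noteq> V - {u}" using R cf(2) by blast
    moreover have "?R \<noteq> {}" using reach_self[OF v] by blast
    moreover have "?R \<subseteq> V - {u}" using R uv(1) by blast
    ultimately obtain x w where xw: "x \<in> ?R" "w \<in> V - {u}" "w \<notin> ?R" "{x, w} \<in> E"
      using conn_cross[OF conn_minus, of u ?R] uv(1) cf(2) by blast
    have w: "w \<in> S" using reach_step[OF xw(1,4)] xw by blast
    obtain p where p: "distinct p" "p \<noteq> []" "hd p = v" "last p = x" "set p \<subseteq> V - S" "path_edges p \<subseteq> E"
      using xw(1) by (auto simp: reach_def)
    have eq: "path_edges (u # p @ [w]) = {{u, v}, {x, w}} \<union> path_edges p"
      using p by (simp add: path_edges_Cons path_edges_snoc hd_append)
    show ?thesis
      by (rule that[of u w p "{u, v}"])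
        (use uv w xw p eq uvE in \<open>auto simp del: path_edges.simps\<close>)
  qed
qed

text \<open>Here \<open>k\<close> is the number of edges of the ear. The two smaller discs share
  these edges and the k + 1 vertices of the ear, and each ear edge belongs to both new cycles. Both
  discs lose edges, as each lacks the part of the old cycle that bounds the other.\<close>

lemma cyc_divide:
  assumes c: "cyc S F" and nf: "region_edges F \<noteq> F \<or> region_verts F \<noteq> S"
  obtains S1 F1 S2 F2 k where "cyc S1 F1" "cyc S2 F2"
    "card (region_edges F1) < card (region_edges F)" "card (region_edges F2) < card (region_edges F)"
    "card (region_verts F) + (k + 1) = card (region_verts F1) + card (region_verts F2)"
    "card (region_edges F) + k = card (region_edges F1) + card (region_edges F2)"
    "card S1 + card S2 = card S + 2 * k"
proof -
  obtain u w zs e where e: "u \<in> S" "w \<in> S" "u \<noteq> w" "distinct (u # zs @ [w])" "set zs \<inter> S = {}"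
    "path_edges (u # zs @ [w]) \<subseteq> E" "e \<in> path_edges (u # zs @ [w])" "e \<in> region_edges F" "e \<notin> F"
    using ear[OF assms] by metis
  obtain xs ys where s: "distinct (u # xs @ [w])" "distinct (u # ys @ [w])"
    "set xs \<inter> set ys = {}" "xs @ ys \<noteq> []" "S = {u, w} \<union> set xs \<union> set ys"
    "F = path_edges (u # xs @ [w]) \<union> path_edges (u # ys @ [w])"
    using cyc_split[OF c e(1-3)] by metis
  define F1 where "F1 = path_edges (u # xs @ [w])"
  define F2 where "F2 = path_edges (u # ys @ [w])"
  define F3 where "F3 = path_edges (u # zs @ [w])"
  have F: "F = F1 \<union> F2" using s(6) by (simp add: F1_def F2_def)
  have E: "F1 \<subseteq> E" "F2 \<subseteq> E" "F3 \<subseteq> E" using cyc_facts(1)[OF c] e(6) F by (auto simp: F3_def)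
  have dis: "set xs \<inter> set zs = {}" "set ys \<inter> set zs = {}" using s(5) e(5) by auto
  have ne: "xs @ zs \<noteq> []" "ys @ zs \<noteq> []"
    using e(7,9) F by (auto simp: F1_def F2_def)
  have pair: "card f = 2" if "f \<in> F1 \<or> f \<in> F2" for f using that E card_edge by blast
  have D: "F1 \<inter> F3 = {}" "F2 \<inter> F3 = {}"
    using path_edges_disjoint[OF s(1) e(4) dis(1) ne(1)] path_edges_disjoint[OF s(2) e(4) dis(2) ne(2)] pair
    unfolding F1_def F2_def F3_def by blast+
  have "drawn F3 \<inter> inside (drawn (F1 \<union> F2)) \<noteq> {}"
  proof -
    have "e \<in> E" using e(6,7) by blast
    then show ?thesis
      using region_edge_inside[OF cyc_facts(1)[OF c] e(8,9)] open_edge(3)[of e] e(7) F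
      unfolding drawn_def F3_def by blast
  qed
  note th = theta[OF s(1,2) e(4) s(3) dis s(4) ne F1_def F2_def F3_def E this]
  have neF: "F1 \<noteq> {}" "F2 \<noteq> {}"
    unfolding F1_def F2_def by (auto simp: path_edges_Cons)
  have sub: "F1 \<union> F3 \<subseteq> region_edges (F1 \<union> F3)" "F2 \<union> F3 \<subseteq> region_edges (F2 \<union> F3)"
    using subset_region_edges[of "F1 \<union> F3"] subset_region_edges[of "F2 \<union> F3"] E by blast+
  have lt1: "region_edges (F1 \<union> F3) \<subset> region_edges F"
    using th(1,2) sub neF D unfolding F by blast
  have lt2: "region_edges (F2 \<union> F3) \<subset> region_edges F"
    using th(1,2) sub neF D unfolding F by blast
  have c3: "card F3 = length zs + 1" unfolding F3_def using card_path_edges[OF e(4)] by simp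
  have v3: "card (set (u # zs @ [w])) = length zs + 2" using distinct_card[OF e(4)] by simp
  have c1: "cyc ({u, w} \<union> set xs \<union> set zs) (F1 \<union> F3)"
    using cyc_join[OF s(1) e(4) dis(1) ne(1)] E unfolding F1_def F3_def by blast
  have c2: "cyc ({u, w} \<union> set ys \<union> set zs) (F2 \<union> F3)"
    using cyc_join[OF s(2) e(4) dis(2) ne(2)] E unfolding F2_def F3_def by blast
  have cs: "card ({u, w} \<union> set as \<union> set bs) = 2 + length as + length bs"
    if "distinct (u # as @ [w])" "distinct (u # bs @ [w])" "set as \<inter> set bs = {}" for as bs
  proof -
    have "{u, w} \<union> set as \<union> set bs = set (u # w # as @ bs)" by auto
    moreover have "distinct (u # w # as @ bs)" using that by auto
    ultimately show ?thesis using distinct_card by fastforce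
  qed
  show ?thesis
  proof (rule that[OF c1 c2, of "length zs + 1"])
    show "card (region_edges (F1 \<union> F3)) < card (region_edges F)"
      "card (region_edges (F2 \<union> F3)) < card (region_edges F)"
      using lt1 lt2 finite_region psubset_card_mono by blast+
    show "card (region_verts F) + (length zs + 1 + 1) = card (region_verts (F1 \<union> F3)) + card (region_verts (F2 \<union> F3))"
      using card_Un_Int[OF finite_region(1)[of "F1 \<union> F3"] finite_region(1)[of "F2 \<union> F3"]] th(3,4) v3 F by simp
    show "card (region_edges F) + (length zs + 1) = card (region_edges (F1 \<union> F3)) + card (region_edges (F2 \<union> F3))"
      using card_Un_Int[OF finite_region(2)[of "F1 \<union> F3"] finite_region(2)[of "F2 \<union> F3"]] th(1,2) c3 F by simp
    show "card ({u, w} \<union> set xs \<union> set zs) + card ({u, w} \<union> set ys \<union> set zs) = card S + 2 * (length zs + 1)"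
      using cs s(1-3,5) e(4) dis by simp
  qed
qed

text \<open>Euler's formula for the disc, with every face bounded by at least four edges.\<close>

lemma disc_count: "cyc S F \<Longrightarrow> 2 * card (region_edges F) + card S + 4 \<le> 4 * card (region_verts F)"
proof (induction "card (region_edges F)" arbitrary: S F rule: less_induct)
  case less
  show ?case
  proof (cases "region_edges F = F \<and> region_verts F = S")
    case True
    \<comment> \<open>With l vertices and at most l edges the claim follows from 3 l + 4 <= 4 l,
      that is, from l >= 4.\<close>
    then show ?thesis using card_cyc[OF less.prems] cyc_facts(4)[OF less.prems] by auto
  next
    case False
    then obtain S1 F1 S2 F2 k where *: "cyc S1 F1" "cyc S2 F2"
      "card (region_edges F1) < card (region_edges F)" "card (region_edges F2) < card (region_edges F)"
      "card (region_verts F) + (k + 1) = card (region_verts F1) + card (region_verts F2)"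
      "card (region_edges F) + k = card (region_edges F1) + card (region_edges F2)"
      "card S1 + card S2 = card S + 2 * k"
      using cyc_divide[OF less.prems] by metis
    \<comment> \<open>The sum of the two estimates is 2 (e + k) + (l + 2 k) + 8 <= 4 (v + k + 1), in
      which \<open>k\<close> cancels.\<close>
    show ?thesis using less.hyps[OF *(3,1)] less.hyps[OF *(4,2)] *(5-7) by linarith
  qed
qed

section \<open>A face turned inside out\<close>

lemma cyc_exists:
  assumes "3 \<le> card V"
  shows "\<exists>S F. cyc S F"
proof -
  obtain a where a: "a \<in> V" using assms by (metis card.empty ex_in_conv not_numeral_le_zero)
  have big: "\<not> V \<subseteq> {x, y}" for x y
  proof
    assume "V \<subseteq> {x, y}"
    then have "card V \<le> card {x, y}" by (intro card_mono) auto
    then show False using assms by (simp add: card_insert_if split: if_splits)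
  qed
  \<comment> \<open>Two neighbours \<open>b\<close> and \<open>c\<close> of \<open>a\<close> are
    joined by a path that avoids \<open>a\<close>; together with \<open>a\<close> it forms a
    cycle.\<close>
  obtain b where b: "b \<in> V" "b \<noteq> a" "{a, b} \<in> E"
    using conn_cross[OF conn_V, of "{a}"] a big[of a a] by (metis empty_not_insert insert_absorb2 insert_subset order_refl singletonD singletonI empty_subsetI)
  have "{a} \<noteq> V - {b}" using big[of a b] by blast
  then obtain c where c: "c \<in> V - {b}" "c \<noteq> a" "{a, c} \<in> E"
    using conn_cross[OF conn_minus[OF b(1)], of "{a}"] a b by auto
  let ?R = "reach (V - {a}) b"
  have R: "?R \<subseteq> V - {a}" "b \<in> ?R" using reach_subset reach_self b by auto
  have "?R = V - {a}"
  proof (rule ccontr)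
    assume "?R \<noteq> V - {a}"
    then obtain x y where "x \<in> ?R" "y \<in> V - {a}" "y \<notin> ?R" "{x, y} \<in> E"
      using conn_cross[OF conn_minus[OF a], of ?R] R by blast
    then show False using reach_step by blast
  qed
  then have "c \<in> ?R" using c by auto
  then obtain p where p: "distinct p" "p \<noteq> []" "hd p = b" "last p = c" "set p \<subseteq> V - {a}" "path_edges p \<subseteq> E"
    unfolding reach_def by blast
  have "b \<noteq> c" using c by auto
  then have "2 \<le> length p" using p by (cases p; cases "tl p") auto
  moreover have "path_edges (a # p @ [a]) = {{a, b}, {c, a}} \<union> path_edges p"
    using p by (simp add: path_edges_Cons path_edges_snoc hd_append)
  ultimately have "cyc (set (a # p)) (path_edges (a # p @ [a]))"
    unfolding cyc_def using p b c by (intro exI[of _ a] exI[of _ p]) (auto simp: insert_commute)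
  then show ?thesis by blast
qed

text \<open>A cycle with the fewest edges in its disc cannot be divided further.\<close>

lemma face_exists:
  assumes "3 \<le> card V"
  obtains S F where "cyc S F" "region_edges F = F" "region_verts F = S"
proof -
  obtain x where x: "case x of (S, F) \<Rightarrow> cyc S F"
      "\<And>y. (case y of (S, F) \<Rightarrow> cyc S F) \<Longrightarrow> card (region_edges (snd x)) \<le> card (region_edges (snd y))"
    using cyc_exists[OF assms]
      ex_has_least_nat[of "\<lambda>(S, F). cyc S F" _ "\<lambda>x. card (region_edges (snd x))"] by (metis case_prodI)
  obtain S F where SF: "x = (S, F)" by force
  have c: "cyc S F" using x SF by simp
  have "region_edges F = F \<and> region_verts F = S"
  proof (rule ccontr)
    assume "\<not> ?thesis"
    then obtain S1 F1 where "cyc S1 F1" "card (region_edges F1) < card (region_edges F)"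
      using cyc_divide[OF c] by metis
    then show False using x(2)[of "(S1, F1)"] SF by simp
  qed
  then show ?thesis using that c by blast
qed

lemma card_edges_le:
  assumes "3 \<le> card V"
  shows "card E + 2 \<le> 2 * card V"
proof -
  obtain S F where c: "cyc S F" and face: "region_edges F = F" "region_verts F = S"
    using face_exists[OF assms] .
  note cf = cyc_facts[OF c]
  obtain z where z: "z \<in> inside (drawn F)"
    using cyc_simple_path[OF c] Jordan_inside_outside by (metis ex_in_conv)
  have noV: "\<phi> x \<notin> inside (drawn F)" if "x \<in> V" for x
  proof
    assume *: "\<phi> x \<in> inside (drawn F)"
    then have "x \<in> S" using that face by (auto simp: region_verts_def region_def)
    then show False using * that vert_in_drawn[OF cf(1)] cf(3) inside_no_overlap[of "drawn F"] by blast
  qed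
  have noE: "\<Gamma> e \<inter> inside (drawn F) = {}" if "e \<in> E" for e
  proof (rule ccontr)
    assume *: "\<not> ?thesis"
    have "\<phi> ` e \<inter> inside (drawn F) = {}" using noV edge_subset[OF that] by blast
    with * have **: "(\<Gamma> e - \<phi> ` e) \<inter> inside (drawn F) \<noteq> {}" by blast
    then have "e \<notin> F" using inside_no_overlap[of "drawn F"] unfolding drawn_def by blast
    then have "e \<in> region_edges F" using open_edge_in_inside(2)[OF that cf(1) _ **] that
      by (simp add: region_edges_def)
    with \<open>e \<notin> F\<close> show False using face by simp
  qed
  define f where "f = (\<lambda>x. inverse (x - z))"
  \<comment> \<open>The convention \<open>inverse 0 = 0\<close> makes the inversion injective on the
    whole plane, \<open>z\<close> included.\<close>
  have inj: "inj f" by (auto simp: f_def inj_def)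
  interpret inv: biconnected_triangle_free_plane_graph V E "f \<circ> \<phi>" "\<lambda>e. f ` \<Gamma> e"
  proof
    show "\<exists>g. arc g \<and> path_image g = f ` \<Gamma> {u, v} \<and> pathstart g = (f \<circ> \<phi>) u \<and> pathfinish g = (f \<circ> \<phi>) v"
      if e: "{u, v} \<in> E" for u v
    proof -
      obtain g where g: "arc g" "path_image g = \<Gamma> {u, v}" "pathstart g = \<phi> u" "pathfinish g = \<phi> v"
        using edge_arc[OF e] by blast
      \<comment> \<open>The only discontinuity is at \<open>z\<close>, which no edge meets because
        the face is empty.\<close>
      have "continuous_on (path_image g) f"
        unfolding f_def g(2) using noE[OF e] z by (intro continuous_intros) auto
      then have "arc (f \<circ> g)"
        using g(1) inj unfolding arc_def
        by (metis comp_inj_on inj_on_subset path_continuous_image subset_UNIV)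
      then show ?thesis using g by (intro exI[of _ "f \<circ> g"]) (auto simp: path_image_compose pathstart_compose pathfinish_compose)
    qed
    show "inj_on (f \<circ> \<phi>) V" using inj inj_\<phi> by (auto simp: inj_on_def inj_def)
    show "f ` \<Gamma> e \<inter> (f \<circ> \<phi>) ` V = (f \<circ> \<phi>) ` e" if "e \<in> E" for e
      unfolding image_comp[symmetric] image_Int[OF inj, symmetric] edge_verts[OF that] ..
    show "f ` \<Gamma> e \<inter> f ` \<Gamma> e' \<subseteq> (f \<circ> \<phi>) ` V" if "e \<in> E" "e' \<in> E" "e \<noteq> e'" for e e'
      unfolding image_comp[symmetric] image_Int[OF inj, symmetric] using edges_meet[OF that] by (rule image_mono)
  qed (fact finite_V edge_ends conn_V conn_minus triangle_free)+
  have dF: "inv.drawn F = f ` drawn F" by (auto simp: inv.drawn_def drawn_def)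
  have "f ` outside (drawn F) \<subseteq> inside (inv.drawn F)"
    unfolding dF unfolding f_def by (rule inversion_outside[OF compact_drawn[OF cf(1)] z])
  moreover have "\<Gamma> e \<subseteq> drawn F \<union> outside (drawn F)" if "e \<in> E" for e
    using noE[OF that] inside_Un_outside[of "drawn F"] by blast
  ultimately have "f ` \<Gamma> e \<subseteq> inv.region F" if "e \<in> E" for e
    using that unfolding inv.region_def dF by blast
  then have "inv.region_edges F = E" by (auto simp: inv.region_edges_def)
  moreover have "card (inv.region_verts F) \<le> card V"
    using finite_V by (intro card_mono) (auto simp: inv.region_verts_def)
  \<comment> \<open>The disc now holds all edges and at most all vertices. The fact \<open>c\<close>
    applies to the inverted drawing because \<open>cyc\<close> depends on \<open>E\<close>
    alone.\<close>
  ultimately show ?thesis using inv.disc_count[OF c] by simp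
qed

end

section \<open>Arrangements of spiders\<close>

text \<open>
  The key \<open>(i, s, k)\<close> stands for the bar at distance \<open>k\<close> from the centre in leg \<open>s\<close> of the \<open>i\<close>-th spider;
  the centre itself is \<open>(i, 0, 0)\<close>.  Leg 0 is a stack below the centre, legs 1 and 2 are stacks above
  it, shifted so far to the left and to the right that they do not overlap.
\<close>

type_synonym key = "nat \<times> nat \<times> nat"

fun depth :: "key \<Rightarrow> nat" where "depth (i, s, k) = k"

text \<open>At distance 0 every leg would give another name to the centre; leg 0 is made its only
  one.\<close>

fun valid_key :: "key \<Rightarrow> bool" where "valid_key (i, s, k) \<longleftrightarrow> s < 3 \<and> (k = 0 \<longrightarrow> s = 0)"

text \<open>A centre is its own parent, so a set of keys can be closed under \<open>parent\<close>
  without exceptions.\<close>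

fun parent :: "key \<Rightarrow> key" where
  "parent (i, s, k) = (if k \<le> 1 then (i, 0, 0) else (i, s, k - 1))"

text \<open>The shift 2/3 lets legs 1 and 2 overlap the centre in length 1/3 each and leaves a gap
  of 1/3 between them. A spider has width 7/3, so the spacing 6 separates the spiders.\<close>

fun key_x :: "key \<Rightarrow> real" where
  "key_x (i, s, k) = 6 * real i + (if s = 0 then 0 else if s = 1 then - 2 / 3 else 2 / 3)"

fun key_y :: "key \<Rightarrow> int" where
  "key_y (i, s, k) = (if s = 0 then - int k else int k)"

definition key_bar :: "key \<Rightarrow> (real \<times> real) set" where
  "key_bar k = {key_x k..key_x k + 1} \<times> {real_of_int (key_y k)}"

lemma bar_key_bar: "bar (key_bar k)"
  unfolding bar_def key_bar_def by blast

section \<open>Visibility between the bars of spiders\<close>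

lemma same_block:
  assumes "key_x (i, s, k) \<le> x" "x \<le> key_x (i, s, k) + 1" "key_x (j, t, l) \<le> x" "x \<le> key_x (j, t, l) + 1"
  shows "i = j"
proof (rule ccontr)
  assume "i \<noteq> j"
  then have "real i + 1 \<le> real j \<or> real j + 1 \<le> real i" by linarith
  then show False using assms by (auto split: if_splits)
qed

lemma key_bar_disjoint:
  assumes "valid_key k" "valid_key l" "k \<noteq> l"
  shows "key_bar k \<inter> key_bar l = {}"
proof (rule ccontr)
  obtain i s m j t n where e: "k = (i, s, m)" "l = (j, t, n)" by (metis prod_cases3)
  assume "\<not> ?thesis"
  then obtain x where x: "key_x k \<le> x" "x \<le> key_x k + 1" "key_x l \<le> x" "x \<le> key_x l + 1"
    and y: "key_y k = key_y l"
    unfolding key_bar_def by auto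
  have "i = j" using x e same_block by blast
  then show False using x y e assms by (auto split: if_splits)
qed

lemma sees_sym: "sees \<A> S T = sees \<A> T S"
  unfolding sees_def by (simp only: disj_commute)

text \<open>A bar at a height strictly between the two that starts at the same abscissa as one of
  them extends across the whole rectangle and blocks it.\<close>

lemma sees_keysD:
  assumes "sees (key_bar ` K) (key_bar k) (key_bar l)"
  obtains p q where "p < q" "key_x k \<le> p" "q \<le> key_x k + 1" "key_x l \<le> p" "q \<le> key_x l + 1"
    "key_y k \<noteq> key_y l"
    "\<And>u. u \<in> K \<Longrightarrow> key_y k < key_y u \<and> key_y u < key_y l \<or> key_y l < key_y u \<and> key_y u < key_y k \<Longrightarrow>
      key_x u \<noteq> key_x k \<and> key_x u \<noteq> key_x l"
proof -
  obtain p q c d where s: "p < q" "c < d"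
    "{p..q} \<times> {c} \<subseteq> key_bar k \<and> {p..q} \<times> {d} \<subseteq> key_bar l \<or> {p..q} \<times> {c} \<subseteq> key_bar l \<and> {p..q} \<times> {d} \<subseteq> key_bar k"
    "\<And>U. U \<in> key_bar ` K \<Longrightarrow> ({p<..<q} \<times> {c<..<d}) \<inter> U = {}"
    using assms unfolding sees_def by metis
  have ends: "p \<in> {p..q}" "q \<in> {p..q}" using s(1) by auto
  have b: "key_x m \<le> p \<and> q \<le> key_x m + 1 \<and> z = real_of_int (key_y m)" if "{p..q} \<times> {z} \<subseteq> key_bar m" for m z
  proof -
    have "(p, z) \<in> key_bar m" "(q, z) \<in> key_bar m" using that ends by blast+
    then show ?thesis by (simp add: key_bar_def)
  qed
  have x: "key_x k \<le> p" "q \<le> key_x k + 1" "key_x l \<le> p" "q \<le> key_x l + 1"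
    and y: "{c, d} = {real_of_int (key_y k), real_of_int (key_y l)}"
    using s(3) b by blast+
  show ?thesis
  proof (rule that[OF s(1) x])
    show "key_y k \<noteq> key_y l" using y s(2) by (auto simp: doubleton_eq_iff)
    fix u assume u: "u \<in> K" "key_y k < key_y u \<and> key_y u < key_y l \<or> key_y l < key_y u \<and> key_y u < key_y k"
    have cd: "c < real_of_int (key_y u)" "real_of_int (key_y u) < d"
      using y u(2) s(2) by (auto simp: doubleton_eq_iff)
    show "key_x u \<noteq> key_x k \<and> key_x u \<noteq> key_x l"
    proof (rule ccontr)
      assume "\<not> ?thesis"
      then have "key_x u \<le> p" "q \<le> key_x u + 1" using x by auto
      then have "((p + q) / 2, real_of_int (key_y u)) \<in> ({p<..<q} \<times> {c<..<d}) \<inter> key_bar u"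
        using s(1) cd by (auto simp: key_bar_def)
      then show False using s(4) u(1) by blast
    qed
  qed
qed

text \<open>Overlap forces the same spider, and not legs 1 and 2. If \<open>k\<close> is not the
  parent of \<open>l\<close>, then that parent is a bar of \<open>K\<close> between them and blocks
  the view: beyond distance 1 it lies in the column of \<open>l\<close>.\<close>

lemma sees_imp_parent:
  assumes K: "\<And>k. k \<in> K \<Longrightarrow> valid_key k \<and> parent k \<in> K"
    and k: "k \<in> K" and l: "l \<in> K" and sees: "sees (key_bar ` K) (key_bar k) (key_bar l)"
    and le: "depth k \<le> depth l"
  shows "0 < depth l \<and> parent l = k"
proof -
  obtain p q where pq: "p < q" "key_x k \<le> p" "q \<le> key_x k + 1" "key_x l \<le> p" "q \<le> key_x l + 1"
    and y: "key_y k \<noteq> key_y l"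
    and block: "\<And>u. u \<in> K \<Longrightarrow> key_y k < key_y u \<and> key_y u < key_y l \<or> key_y l < key_y u \<and> key_y u < key_y k \<Longrightarrow>
      key_x u \<noteq> key_x k \<and> key_x u \<noteq> key_x l"
    using sees_keysD[OF sees] by metis
  obtain i s m j t n where e: "k = (i, s, m)" "l = (j, t, n)" by (metis prod_cases3)
  have "i = j" using same_block[of i s m p j t n] pq e by simp
  have v: "s < 3" "m = 0 \<longrightarrow> s = 0" "t < 3" "n = 0 \<longrightarrow> t = 0" using K[OF k] K[OF l] e by auto
  have st: "s = t \<or> s = 0 \<or> t = 0"
    using pq e \<open>i = j\<close> v by (auto split: if_splits)
  have n: "0 < n" using le y e v by (cases "n = 0") auto
  have "parent l = k"
  proof (rule ccontr)
    assume ne: "parent l \<noteq> k"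
    let ?u = "parent l"
    note bl = block[OF conjunct2[OF K[OF l]]]
    show False
    proof (cases "n = 1")
      case True
      \<comment> \<open>Both bars are next to the centre, one above and one below. The lower one is
        in leg 0, in the column of the centre, so the centre blocks.\<close>
      then have "m = 1" using ne le e v \<open>i = j\<close> by (cases "m = 0") auto
      then show False using bl y st True e v \<open>i = j\<close> by (auto split: if_splits)
    next
      case False
      have "s = t \<longrightarrow> m < n - 1" using False ne le y e n \<open>i = j\<close> by (cases "m = n"; cases "m = n - 1") auto
      have "key_x ?u = key_x l" using False n e by auto
      moreover have "key_y k < key_y ?u \<and> key_y ?u < key_y l \<or> key_y l < key_y ?u \<and> key_y ?u < key_y k"
      proof (cases "t = 0")
        case t: True
        have "key_y l = - int n" "key_y ?u = 1 - int n" using t False n e by auto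
        moreover have "1 - int n < key_y k"
          using \<open>s = t \<longrightarrow> m < n - 1\<close> t False n e by (cases "s = 0") auto
        ultimately show ?thesis by linarith
      next
        case t: False
        have "key_y l = int n" "key_y ?u = int n - 1" using t False n e by auto
        moreover have "key_y k < int n - 1"
          using \<open>s = t \<longrightarrow> m < n - 1\<close> st t False n e by (cases "s = 0") auto
        ultimately show ?thesis by linarith
      qed
      ultimately show False using bl by blast
    qed
  qed
  then show ?thesis using n e by simp
qed

text \<open>All heights are integers and these two differ by 1, so no bar comes between; the overlap
  has length at least 1/3.\<close>

lemma sees_parent:
  assumes "valid_key l" "0 < depth l"
  shows "sees (key_bar ` K) (key_bar l) (key_bar (parent l))"
proof -
  obtain i s n where e: "l = (i, s, n)" by (metis prod_cases3)
  let ?p = "parent l"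
  define a where "a = max (key_x l) (key_x ?p)"
  define b where "b = min (key_x l) (key_x ?p) + 1"
  define c where "c = min (key_y l) (key_y ?p)"
  have "a < b" using assms e by (auto simp: a_def b_def)
  have y: "key_y l = c \<and> key_y ?p = c + 1 \<or> key_y ?p = c \<and> key_y l = c + 1"
    using assms e by (auto simp: c_def)
  have x: "{a..b} \<subseteq> {key_x l..key_x l + 1}" "{a..b} \<subseteq> {key_x ?p..key_x ?p + 1}"
    by (auto simp: a_def b_def)
  have sub: "{a..b} \<times> {real_of_int c} \<subseteq> key_bar l \<and> {a..b} \<times> {real_of_int (c + 1)} \<subseteq> key_bar ?p \<or>
    {a..b} \<times> {real_of_int c} \<subseteq> key_bar ?p \<and> {a..b} \<times> {real_of_int (c + 1)} \<subseteq> key_bar l"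
    unfolding key_bar_def using x y by (metis Sigma_mono order_refl)
  have free: "({a<..<b} \<times> {real_of_int c<..<real_of_int (c + 1)}) \<inter> U = {}" if U: "U \<in> key_bar ` K" for U
  proof -
    obtain u where u: "U = key_bar u" using U by blast
    have "\<not> (real_of_int c < real_of_int (key_y u) \<and> real_of_int (key_y u) < real_of_int (c + 1))"
      unfolding of_int_less_iff by linarith
    then show ?thesis unfolding u key_bar_def by auto
  qed
  have "real_of_int c < real_of_int (c + 1)" by simp
  with \<open>a < b\<close> sub free show ?thesis unfolding sees_def by blast
qed

section \<open>Forests of keys realising oriented edges\<close>

definition centres :: "key set \<Rightarrow> (key \<Rightarrow> 'a) \<Rightarrow> 'a \<Rightarrow> key set" where
  "centres K L v = {k \<in> K. depth k = 0 \<and> L k = v}"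

abbreviation outs :: "('a \<times> 'a) set \<Rightarrow> 'a \<Rightarrow> 'a set" where "outs A v \<equiv> {p. (v, p) \<in> A}"
abbreviation ins :: "('a \<times> 'a) set \<Rightarrow> 'a \<Rightarrow> 'a set" where "ins A v \<equiv> {u. (u, v) \<in> A}"

text \<open>
  \<open>A\<close> is the set of oriented edges realised so far, \<open>L\<close> assigns the bars to the vertices.  The last
  clause bounds the number of centres, because a new centre is only introduced for a vertex all of
  whose bars are full.
\<close>

definition key_forest :: "('a \<times> 'a) set \<Rightarrow> key set \<Rightarrow> (key \<Rightarrow> 'a) \<Rightarrow> bool" where
  "key_forest A K L \<longleftrightarrow> finite K \<and> (\<forall>k\<in>K. valid_key k \<and> parent k \<in> K) \<and>
     bij_betw (\<lambda>k. (L k, L (parent k))) {k \<in> K. 0 < depth k} A \<and>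
     (\<forall>v. centres K L v \<noteq> {} \<longrightarrow> 3 * card (centres K L v) + card (outs A v) \<le> card (ins A v) + 2)"

lemma key_forest_finite: "key_forest A K L \<Longrightarrow> finite A"
  unfolding key_forest_def using bij_betw_finite by fastforce

lemma finite_outs_ins: "finite A \<Longrightarrow> finite (outs A v)" "finite A \<Longrightarrow> finite (ins A v)"
  by (rule finite_subset[of _ "snd ` A"], force, simp) (rule finite_subset[of _ "fst ` A"], force, simp)

text \<open>Each bar that is not a centre stands for one out-edge of its vertex, directed to the
  vertex of its parent.\<close>

lemma card_out_keys:
  assumes "key_forest A K L"
  shows "card {k \<in> K. 0 < depth k \<and> L k = v} = card (outs A v)"
proof -
  have b: "bij_betw (\<lambda>k. (L k, L (parent k))) {k \<in> K. 0 < depth k} A"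
    using assms by (simp add: key_forest_def)
  have "bij_betw (\<lambda>k. (L k, L (parent k))) {k \<in> K. 0 < depth k \<and> L k = v} ({v} \<times> outs A v)"
    by (rule bij_betw_subset[OF b, THEN back_subst[where P = "bij_betw _ _"]])
      (use bij_betw_imp_surj_on[OF b] in \<open>auto simp: image_iff\<close>)
  then show ?thesis by (simp add: bij_betw_same_card card_cartesian_product)
qed

lemma card_in_keys:
  assumes "key_forest A K L"
  shows "card {k \<in> K. 0 < depth k \<and> L (parent k) = v} = card (ins A v)"
proof -
  have b: "bij_betw (\<lambda>k. (L k, L (parent k))) {k \<in> K. 0 < depth k} A"
    using assms by (simp add: key_forest_def)
  have "bij_betw (\<lambda>k. (L k, L (parent k))) {k \<in> K. 0 < depth k \<and> L (parent k) = v} (ins A v \<times> {v})"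
    by (rule bij_betw_subset[OF b, THEN back_subst[where P = "bij_betw _ _"]])
      (use bij_betw_imp_surj_on[OF b] in \<open>auto simp: image_iff\<close>)
  then show ?thesis by (simp add: bij_betw_same_card card_cartesian_product)
qed

text \<open>The maps \<open>f\<close> and \<open>g\<close> enumerate the places for children: one
  beyond each bar of \<open>p\<close> that is not a centre, three around each centre of
  \<open>p\<close>. All are occupied, and each occupant realises its own in-edge of
  \<open>p\<close>.\<close>

lemma full_count:
  assumes kf: "key_forest A K L"
    and full: "\<And>k. valid_key k \<Longrightarrow> 0 < depth k \<Longrightarrow> parent k \<in> K \<Longrightarrow> L (parent k) = p \<Longrightarrow> k \<in> K"
  shows "3 * card (centres K L p) + card (outs A p) \<le> card (ins A p)"
proof -
  have K: "finite K" "\<And>k. k \<in> K \<Longrightarrow> valid_key k" using kf by (auto simp: key_forest_def)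
  define N where "N = {k \<in> K. 0 < depth k \<and> L k = p}"
  define Ch where "Ch = {k \<in> K. 0 < depth k \<and> L (parent k) = p}"
  define f :: "key \<Rightarrow> key" where "f = (\<lambda>(i, s, k). (i, s, Suc k))"
  define g :: "key \<times> nat \<Rightarrow> key" where "g = (\<lambda>((i, s, k), t). (i, t, 1))"
  let ?C = "centres K L p \<times> {0, 1, 2 :: nat}"
  have f: "inj_on f N" by (auto simp: f_def inj_on_def)
  have centre: "\<exists>i. k = (i, 0, 0)" if "k \<in> centres K L p" for k
    using that K(2)[of k] by (cases k) (auto simp: centres_def)
  have g: "inj_on g ?C"
  proof (rule inj_onI)
    fix x y assume "x \<in> ?C" "y \<in> ?C" "g x = g y"
    moreover then obtain i j where "fst x = (i, 0, 0)" "fst y = (j, 0, 0)"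
      using centre[of "fst x"] centre[of "fst y"] by auto
    ultimately show "x = y" by (cases x; cases y) (auto simp: g_def)
  qed
  have dis: "f ` N \<inter> g ` ?C = {}" by (auto simp: f_def g_def N_def)
  have "f ` N \<subseteq> Ch"
  proof
    fix l assume "l \<in> f ` N"
    then obtain i s k where l: "(i, s, k) \<in> N" "l = (i, s, Suc k)" by (auto simp: f_def)
    have "valid_key l" "0 < depth l" "parent l = (i, s, k)" using l K(2) by (auto simp: N_def)
    then show "l \<in> Ch" using l full[of l] by (auto simp: Ch_def N_def)
  qed
  moreover have "g ` ?C \<subseteq> Ch"
  proof
    fix l assume "l \<in> g ` ?C"
    then obtain i s k t where l: "(i, s, k) \<in> centres K L p" "t \<in> {0, 1, 2 :: nat}" "l = (i, t, 1)"
      by (auto simp: g_def)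
    have "valid_key l" "0 < depth l" "parent l = (i, s, k)" using l K(2) by (auto simp: centres_def)
    then show "l \<in> Ch" using l full[of l] by (auto simp: Ch_def centres_def)
  qed
  ultimately have "card (f ` N \<union> g ` ?C) \<le> card Ch"
    using K(1) by (intro card_mono) (auto simp: Ch_def)
  moreover have "finite N" "finite ?C" using K(1) by (auto simp: N_def centres_def)
  ultimately have "card N + card ?C \<le> card Ch"
    using dis f g by (simp add: card_Un_disjoint card_image)
  then show ?thesis
    using card_out_keys[OF kf, of p] card_in_keys[OF kf, of p]
    by (simp add: N_def Ch_def card_cartesian_product mult.commute)
qed

lemma card_insert_ins: "finite A \<Longrightarrow> (v, p) \<notin> A \<Longrightarrow> card (ins (insert (v, p) A) w) = card (ins A w) + (if w = p then 1 else 0)"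
proof -
  assume "finite A" "(v, p) \<notin> A"
  moreover have "ins (insert (v, p) A) w = (if w = p then insert v (ins A w) else ins A w)" by auto
  ultimately show ?thesis using finite_outs_ins(2)[of A w] by auto
qed

text \<open>A bar for \<open>v\<close> is hung on a free place at a bar of \<open>p\<close>; if
  there is none, a new spider with centre \<open>p\<close> is started. As \<open>v\<close> has no
  in-edges yet, it has no centre, so its growing out-degree does not endanger the invariant.\<close>

lemma key_forest_insert:
  assumes kf: "key_forest A K L" and new: "(v, p) \<notin> A" "v \<noteq> p" and src: "\<And>u. (u, v) \<notin> A"
  shows "\<exists>K L. key_forest (insert (v, p) A) K L"
proof -
  have fin: "finite K" "finite A" using kf key_forest_finite by (auto simp: key_forest_def)
  have K: "\<And>k. k \<in> K \<Longrightarrow> valid_key k" "\<And>k. k \<in> K \<Longrightarrow> parent k \<in> K"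
    and bij: "bij_betw (\<lambda>k. (L k, L (parent k))) {k \<in> K. 0 < depth k} A"
    and cen: "\<And>w. centres K L w \<noteq> {} \<Longrightarrow> 3 * card (centres K L w) + card (outs A w) \<le> card (ins A w) + 2"
    using kf by (auto simp: key_forest_def)
  \<comment> \<open>A centre of \<open>v\<close> would give 3 <= 0 + 2.\<close>
  have noc: "centres K L v = {}"
  proof (rule ccontr)
    assume "centres K L v \<noteq> {}"
    moreover have "finite (centres K L v)" using fin by (simp add: centres_def)
    ultimately have "1 \<le> card (centres K L v)" by (simp add: Suc_leI card_gt_0_iff)
    then show False using cen[of v] \<open>centres K L v \<noteq> {}\<close> src by simp
  qed
  have outs: "outs (insert (v, p) A) w = outs A w" if "w \<noteq> v" for w using that by auto
  have bij': "bij_betw (\<lambda>k. (L' k, L' (parent k))) {k \<in> K'. 0 < depth k} (insert (v, p) A)"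
    if k: "{l \<in> K'. 0 < depth l} = insert k {l \<in> K. 0 < depth l}" "k \<notin> K" "L' k = v" "L' (parent k) = p"
      and L: "\<And>l. l \<in> K \<Longrightarrow> L' l = L l" for K' L' k
  proof -
    have "bij_betw (\<lambda>k. (L' k, L' (parent k))) {k \<in> K. 0 < depth k} A"
      using bij by (rule bij_betw_cong[THEN iffD1, rotated]) (use L K(2) in auto)
    then have "bij_betw (\<lambda>k. (L' k, L' (parent k))) ({k \<in> K. 0 < depth k} \<union> {k}) (A \<union> {(v, p)})"
      using notIn_Un_bij_betw[of k "{k \<in> K. 0 < depth k}" "\<lambda>k. (L' k, L' (parent k))" A] k new by simp
    then show ?thesis using k by simp
  qed
  show ?thesis
  proof (cases "\<exists>k. valid_key k \<and> 0 < depth k \<and> parent k \<in> K \<and> L (parent k) = p \<and> k \<notin> K")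
    case True
    then obtain k where k: "valid_key k" "0 < depth k" "parent k \<in> K" "L (parent k) = p" "k \<notin> K" by blast
    define L' where "L' = L(k := v)"
    have L: "L' l = L l" if "l \<in> K" for l using that k by (auto simp: L'_def)
    have C: "centres (insert k K) L' w = centres K L w" for w
      unfolding centres_def using L k by auto
    have "3 * card (centres K L w) + card (outs (insert (v, p) A) w) \<le> card (ins (insert (v, p) A) w) + 2"
      if w: "centres K L w \<noteq> {}" for w
      using cen[OF w] noc w outs[of w] card_insert_ins[OF fin(2) new(1), of w] by (cases "w = v") auto
    moreover have "{l \<in> insert k K. 0 < depth l} = insert k {l \<in> K. 0 < depth l}" using k by auto
    ultimately have "key_forest (insert (v, p) A) (insert k K) L'"
      unfolding key_forest_def C using bij'[of "insert k K" k L'] fin K k L by (auto simp: L'_def)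
    then show ?thesis by blast
  next
    case False
    have "\<exists>i. i \<notin> fst ` K" using fin(1) by (meson ex_new_if_finite finite_imageI infinite_UNIV_nat)
    then obtain i where i: "i \<notin> fst ` K" by blast
    define c k :: key where "c = (i, 0, 0)" and "k = (i, 0, 1)"
    have ck: "valid_key c" "valid_key k" "parent c = c" "parent k = c" "depth c = 0" "depth k = 1" "c \<noteq> k"
      by (auto simp: c_def k_def)
    have nK: "c \<notin> K" "k \<notin> K" using i by (force simp: c_def k_def)+
    define L' where "L' = L(c := p, k := v)"
    have L: "L' l = L l" if "l \<in> K" for l using that nK by (auto simp: L'_def)
    let ?K = "insert c (insert k K)"
    have C: "centres ?K L' w = (if w = p then insert c (centres K L w) else centres K L w)" for w
      unfolding centres_def using L ck nK by (auto simp: L'_def)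
    have finC: "finite (centres K L p)" "c \<notin> centres K L p" using fin nK by (auto simp: centres_def)
    have "3 * card (centres ?K L' w) + card (outs (insert (v, p) A) w) \<le> card (ins (insert (v, p) A) w) + 2"
      if w: "centres ?K L' w \<noteq> {}" for w
    proof (cases "w = p")
      case True
      \<comment> \<open>With all places full, the bound holds without the summand 2. The new centre
        adds 3 on the left, and the new in-edge adds 1 on the right.\<close>
      have "3 * card (centres K L p) + card (outs A p) \<le> card (ins A p)"
        using full_count[OF kf] False by blast
      then show ?thesis
        using True C[of p] finC card_insert_ins[OF fin(2) new(1), of p] outs[of p] new(2) by simp
    next
      case False
      then have "centres K L w \<noteq> {}" using w C by simp
      then show ?thesis using False noc outs[of w] card_insert_ins[OF fin(2) new(1), of w] cen[of w] C[of w]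
        by (cases "w = v") auto
    qed
    moreover have "{l \<in> ?K. 0 < depth l} = insert k {l \<in> K. 0 < depth l}" using ck by auto
    ultimately have "key_forest (insert (v, p) A) ?K L'"
      unfolding key_forest_def using bij'[of ?K k L'] fin K ck nK L by (auto simp: L'_def)
    then show ?thesis by blast
  qed
qed

lemma key_forest_star:
  assumes "finite N" "key_forest A K L" "v \<notin> N" "\<And>u. (u, v) \<notin> A"
  shows "\<exists>K L. key_forest (A \<union> {v} \<times> N) K L"
  using assms
proof (induction N rule: finite_induct)
  case (insert p N)
  then obtain K L where kf: "key_forest (A \<union> {v} \<times> N) K L" by blast
  have eq: "A \<union> {v} \<times> insert p N = insert (v, p) (A \<union> {v} \<times> N)" by auto
  show ?case
  proof (cases "(v, p) \<in> A")
    case True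
    then have "A \<union> {v} \<times> insert p N = A \<union> {v} \<times> N" by auto
    with kf show ?thesis by metis
  next
    case False
    then show ?thesis unfolding eq using insert by (intro key_forest_insert[OF kf]) auto
  qed
qed auto

section \<open>Orientation along a degeneracy order\<close>

definition oriented_key_forest ::
    "('a \<Rightarrow> 'a \<Rightarrow> bool) \<Rightarrow> 'a set \<Rightarrow> ('a \<times> 'a) set \<Rightarrow> key set \<Rightarrow> (key \<Rightarrow> 'a) \<Rightarrow> bool" where
  "oriented_key_forest R W A K L \<longleftrightarrow> key_forest A K L \<and> A \<subseteq> W \<times> W \<and> (\<forall>v. card (outs A v) \<le> 3) \<and>
    (\<forall>u v. (u, v) \<in> A \<longrightarrow> (v, u) \<notin> A) \<and>
    (\<forall>u\<in>W. \<forall>v\<in>W. R u v \<longleftrightarrow> (u, v) \<in> A \<or> (v, u) \<in> A)"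

text \<open>A vertex with at most 3 neighbours is split off, the rest is treated first, and the
  edges at this vertex are directed away from it. It then has no in-edges while its out-edges are
  inserted.\<close>

lemma oriented_key_forest_exists:
  fixes R :: "'a \<Rightarrow> 'a \<Rightarrow> bool"
  assumes "finite W" and sym: "\<And>u v. R u v \<Longrightarrow> R v u" and irrefl: "\<And>u. \<not> R u u"
    and deg: "\<And>X. X \<subseteq> W \<Longrightarrow> X \<noteq> {} \<Longrightarrow> \<exists>v\<in>X. card {u \<in> X. R v u} \<le> 3"
  shows "\<exists>A K L. oriented_key_forest R W A K L"
  using assms(1) deg
proof (induction W rule: finite_psubset_induct)
  case (psubset W)
  show ?case
  proof (cases "W = {}")
    case True
    have "key_forest {} {} (undefined :: key \<Rightarrow> 'a)"
      by (auto simp: key_forest_def centres_def bij_betw_def)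
    then have "oriented_key_forest R W {} {} undefined"
      by (simp add: oriented_key_forest_def True)
    then show ?thesis by blast
  next
    case False
    then obtain v where v: "v \<in> W" "card {u \<in> W. R v u} \<le> 3" using psubset.prems by blast
    let ?W = "W - {v}" and ?N = "{u \<in> W. R v u}"
    have sub: "?W \<subset> W" using v by blast
    have degW: "\<exists>v\<in>X. card {u \<in> X. R v u} \<le> 3" if "X \<subseteq> ?W" "X \<noteq> {}" for X
      using psubset.prems that by blast
    have "\<exists>A K L. oriented_key_forest R ?W A K L"
      by (rule psubset.IH[OF sub]) (rule degW)
    then obtain A K L where "oriented_key_forest R ?W A K L" by blast
    then have A: "key_forest A K L" "A \<subseteq> ?W \<times> ?W" "\<And>v. card (outs A v) \<le> 3"
      "\<And>u v. (u, v) \<in> A \<Longrightarrow> (v, u) \<notin> A"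
      "\<And>u v. u \<in> ?W \<Longrightarrow> v \<in> ?W \<Longrightarrow> R u v \<longleftrightarrow> (u, v) \<in> A \<or> (v, u) \<in> A"
      unfolding oriented_key_forest_def by blast+
    let ?A = "A \<union> {v} \<times> ?N"
    have "\<exists>K L. key_forest ?A K L"
      using psubset.hyps A irrefl by (intro key_forest_star[OF _ A(1)]) auto
    then obtain K L where "key_forest ?A K L" by blast
    moreover have "?A \<subseteq> W \<times> W" using A(2) v(1) by auto
    moreover have "card (outs ?A w) \<le> 3" for w
    proof (cases "w = v")
      case True
      then have "outs ?A w = ?N" using A(2) by auto
      then show ?thesis using v by simp
    next
      case False
      then have "outs ?A w = outs A w" by auto
      then show ?thesis using A(3) by simp
    qed
    moreover have "(w, u) \<notin> ?A" if "(u, w) \<in> ?A" for u w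
      using that A(2,4) irrefl by auto
    moreover have "R u w \<longleftrightarrow> (u, w) \<in> ?A \<or> (w, u) \<in> ?A" if "u \<in> W" "w \<in> W" for u w
    proof (cases "u = v \<or> w = v")
      case True
      then show ?thesis using A(2) that sym irrefl by auto
    next
      case False
      then show ?thesis using A(5)[of u w] that by auto
    qed
    ultimately have "oriented_key_forest R W ?A K L"
      unfolding oriented_key_forest_def by blast
    then show ?thesis by blast
  qed
qed

section \<open>Triangle-free plane graphs are 3-degenerate\<close>

context plane_graph begin

lemma plane_subgraph:
  assumes "W \<subseteq> V"
  shows "plane_graph W {e \<in> E. e \<subseteq> W} \<phi> \<Gamma>"
proof
  show "finite W" using assms finite_V finite_subset by blast
  show "inj_on \<phi> W" using inj_\<phi> assms inj_on_subset by blast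
  show "\<exists>u\<in>W. \<exists>v\<in>W. u \<noteq> v \<and> e = {u, v}" if "e \<in> {e \<in> E. e \<subseteq> W}" for e
    using edge_ends[of e] that by auto
  show "\<exists>g. arc g \<and> path_image g = \<Gamma> {u, v} \<and> pathstart g = \<phi> u \<and> pathfinish g = \<phi> v"
    if "{u, v} \<in> {e \<in> E. e \<subseteq> W}" for u v
    using edge_arc[of u v] that by simp
  show *: "\<Gamma> e \<inter> \<phi> ` W = \<phi> ` e" if "e \<in> {e \<in> E. e \<subseteq> W}" for e
    using edge_verts[of e] that assms by blast
  show "\<Gamma> e \<inter> \<Gamma> f \<subseteq> \<phi> ` W" if e: "e \<in> {e \<in> E. e \<subseteq> W}" and f: "f \<in> {e \<in> E. e \<subseteq> W}" and "e \<noteq> f" for e f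
  proof
    fix z assume z: "z \<in> \<Gamma> e \<inter> \<Gamma> f"
    then have "z \<in> \<phi> ` V" using edges_meet[of e f] that by blast
    then have "z \<in> \<phi> ` e" using z e edge_verts[of e] by blast
    then show "z \<in> \<phi> ` W" using e by blast
  qed
qed

text \<open>The bounds 2 a - 2 and 2 b - 2 add up, and a + b counts the overlap twice. An overlap of
  at most one vertex thus restores the bound 2 n - 2 for the union.\<close>

lemma sparse_union:
  assumes "A \<subseteq> V" "B \<subseteq> V" and cover: "\<And>e. e \<in> E \<Longrightarrow> e \<subseteq> A \<union> B \<Longrightarrow> e \<subseteq> A \<or> e \<subseteq> B"
    and "card {e \<in> E. e \<subseteq> A} + 2 \<le> 2 * card A" "card {e \<in> E. e \<subseteq> B} + 2 \<le> 2 * card B"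
  shows "card {e \<in> E. e \<subseteq> A \<union> B} + 4 \<le> 2 * card (A \<union> B) + 2 * card (A \<inter> B)"
proof -
  have "{e \<in> E. e \<subseteq> A \<union> B} \<subseteq> {e \<in> E. e \<subseteq> A} \<union> {e \<in> E. e \<subseteq> B}" using cover by blast
  then have "card {e \<in> E. e \<subseteq> A \<union> B} \<le> card ({e \<in> E. e \<subseteq> A} \<union> {e \<in> E. e \<subseteq> B})"
    using finite_E by (intro card_mono) auto
  also have "\<dots> \<le> card {e \<in> E. e \<subseteq> A} + card {e \<in> E. e \<subseteq> B}" by (rule card_Un_le)
  finally show ?thesis
    using assms(4,5) card_Un_Int[of A B] assms(1,2) finite_V finite_subset by fastforce
qed

lemma triangle_free_sparse:
  assumes tf: "\<And>a b c. {a, b} \<in> E \<Longrightarrow> {b, c} \<in> E \<Longrightarrow> {c, a} \<in> E \<Longrightarrow> False"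
    and W: "W \<subseteq> V" "W \<noteq> {}"
  shows "card {e \<in> E. e \<subseteq> W} + 2 \<le> 2 * card W"
proof -
  have "finite W" using W finite_V finite_subset by blast
  then show ?thesis using W
  proof (induction W rule: finite_psubset_induct)
    case (psubset W)
    let ?E = "{e \<in> E. e \<subseteq> W}"
    interpret sub: plane_graph W ?E \<phi> \<Gamma> using plane_subgraph psubset.prems(1) .
    \<comment> \<open>This serves two cases: an empty overlap when \<open>W\<close> is disconnected,
      and a single common vertex when \<open>W\<close> has a cut vertex.\<close>
    have separated: "card ?E + 2 \<le> 2 * card W"
      if A: "A \<subset> W" "A \<noteq> {}" and B: "B \<subset> W" "B \<noteq> {}" and AB: "A \<union> B = W" "card (A \<inter> B) \<le> 1"
        and cross: "\<And>a b. a \<in> W - B \<Longrightarrow> b \<in> W - A \<Longrightarrow> {a, b} \<notin> ?E" for A B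
    proof -
      have "card ?E + 4 \<le> 2 * card W + 2 * card (A \<inter> B)"
        unfolding AB(1)[symmetric]
      proof (rule sparse_union)
        show "A \<subseteq> V" "B \<subseteq> V" using A B psubset.prems by auto
        show "e \<subseteq> A \<or> e \<subseteq> B" if e: "e \<in> E" "e \<subseteq> A \<union> B" for e
        proof (rule ccontr)
          assume no: "\<not> ?thesis"
          obtain x y where xy: "e = {x, y}" using edge_ends e by blast
          have "x \<in> W - B \<and> y \<in> W - A \<or> y \<in> W - B \<and> x \<in> W - A" using no xy e AB(1) by blast
          then show False using cross[of x y] cross[of y x] e xy AB(1) by (auto simp: insert_commute)
        qed
        show "card {e \<in> E. e \<subseteq> A} + 2 \<le> 2 * card A" using psubset.IH[OF A(1)] A psubset.prems by auto
        show "card {e \<in> E. e \<subseteq> B} + 2 \<le> 2 * card B" using psubset.IH[OF B(1)] B psubset.prems by auto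
      qed
      then show ?thesis using AB(2) by linarith
    qed
    consider "card W \<le> 2" | "3 \<le> card W" "\<not> sub.conn W"
      | u where "3 \<le> card W" "u \<in> W" "\<not> sub.conn (W - {u})"
      | "3 \<le> card W" "sub.conn W" "\<And>u. u \<in> W \<Longrightarrow> sub.conn (W - {u})"
    proof -
      assume rule: "card W \<le> 2 \<Longrightarrow> thesis" "3 \<le> card W \<Longrightarrow> \<not> sub.conn W \<Longrightarrow> thesis"
        "\<And>u. 3 \<le> card W \<Longrightarrow> u \<in> W \<Longrightarrow> \<not> sub.conn (W - {u}) \<Longrightarrow> thesis"
        "3 \<le> card W \<Longrightarrow> sub.conn W \<Longrightarrow> (\<And>u. u \<in> W \<Longrightarrow> sub.conn (W - {u})) \<Longrightarrow> thesis"
      have "card W \<le> 2 \<or> 3 \<le> card W" by linarith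
      then show thesis using rule by blast
    qed
    then show ?case
    proof cases
      case 1
      have "?E \<subseteq> (if card W = 2 then {W} else {})"
      proof
        fix e assume e: "e \<in> ?E"
        then have "card e = 2" "e \<subseteq> W" using card_edge by auto
        then have "e = W" using 1 psubset.hyps by (intro card_seteq) auto
        then show "e \<in> (if card W = 2 then {W} else {})" using \<open>card e = 2\<close> by simp
      qed
      then have "card ?E \<le> card (if card W = 2 then {W} else {})"
        by (rule card_mono[rotated]) simp
      moreover have "1 \<le> card W" using psubset by (simp add: Suc_leI card_gt_0_iff)
      ultimately show ?thesis using 1 by (cases "card W = 2") auto
    next
      case 2
      then obtain A where A: "A \<subseteq> W" "A \<noteq> {}" "A \<noteq> W" "\<And>a b. a \<in> A \<Longrightarrow> b \<in> W - A \<Longrightarrow> {a, b} \<notin> ?E"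
        unfolding sub.conn_def by blast
      show ?thesis by (rule separated[of A "W - A"]) (use A in auto)
    next
      case 3
      then obtain A where A: "A \<subseteq> W - {u}" "A \<noteq> {}" "A \<noteq> W - {u}"
        "\<And>a b. a \<in> A \<Longrightarrow> b \<in> W - {u} - A \<Longrightarrow> {a, b} \<notin> ?E"
        unfolding sub.conn_def by blast
      have "insert u A \<inter> (W - A) = {u}" using A 3 by blast
      then have one: "card (insert u A \<inter> (W - A)) \<le> 1" by simp
      show ?thesis
      proof (rule separated[of "insert u A" "W - A", OF _ _ _ _ _ one])
        show "insert u A \<subset> W" "W - A \<subset> W" "insert u A \<noteq> {}" "W - A \<noteq> {}" "insert u A \<union> (W - A) = W"
          using A(1-3) 3(2) by blast+
        show "{a, b} \<notin> ?E" if "a \<in> W - (W - A)" "b \<in> W - insert u A" for a b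
          using A(4)[of a b] that by blast
      qed
    next
      case 4
      interpret sub: biconnected_triangle_free_plane_graph W ?E \<phi> \<Gamma>
        by unfold_locales (use 4 tf in auto)
      show ?thesis using sub.card_edges_le 4(1) by simp
    qed
  qed
qed

text \<open>If all degrees were at least 4, their sum would be at least 4 n. Grouping adjacent pairs
  by their edge, with at most two orders each, bounds the sum by twice the number of edges, hence by
  4 n - 4.\<close>

lemma triangle_free_degenerate:
  assumes tf: "\<And>a b c. {a, b} \<in> E \<Longrightarrow> {b, c} \<in> E \<Longrightarrow> {c, a} \<in> E \<Longrightarrow> False"
    and W: "W \<subseteq> V" "W \<noteq> {}"
  shows "\<exists>v\<in>W. card {u \<in> W. {v, u} \<in> E} \<le> 3"
proof (rule ccontr)
  assume no: "\<not> ?thesis"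
  let ?EW = "{e \<in> E. e \<subseteq> W}"
  have finW: "finite W" using W finite_V finite_subset by blast
  have finE: "finite ?EW" using finite_E by simp
  have "4 * card W = (\<Sum>v\<in>W. 4)" by simp
  also have "\<dots> \<le> (\<Sum>v\<in>W. card {u \<in> W. {v, u} \<in> E})"
  proof (rule sum_mono)
    fix v assume "v \<in> W"
    then show "4 \<le> card {u \<in> W. {v, u} \<in> E}" using no by fastforce
  qed
  also have "\<dots> = card (SIGMA v:W. {u \<in> W. {v, u} \<in> E})"
    using finW by (simp add: card_SigmaI)
  also have "(SIGMA v:W. {u \<in> W. {v, u} \<in> E}) = (\<Union>e\<in>?EW. {(v, u). {v, u} = e})" by auto
  also have "card \<dots> \<le> (\<Sum>e\<in>?EW. card {(v, u). {v, u} = e})" by (rule card_UN_le[OF finE])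
  also have "\<dots> \<le> (\<Sum>e\<in>?EW. 2)"
  proof (rule sum_mono)
    fix e assume "e \<in> ?EW"
    then obtain x y where e: "e = {x, y}" using edge_ends by blast
    have sub: "{(v, u). {v, u} = e} \<subseteq> set [(x, y), (y, x)]"
    proof
      fix p assume "p \<in> {(v, u). {v, u} = e}"
      then have "{fst p, snd p} = {x, y}" using e by (simp add: case_prod_beta)
      then have "fst p = x \<and> snd p = y \<or> fst p = y \<and> snd p = x" by (simp only: doubleton_eq_iff)
      then have "p = (x, y) \<or> p = (y, x)" by (metis prod.collapse)
      then show "p \<in> set [(x, y), (y, x)]" by auto
    qed
    have "card {(v, u). {v, u} = e} \<le> card (set [(x, y), (y, x)])"
      by (rule card_mono[OF finite_set sub])
    also have "\<dots> \<le> length [(x, y), (y, x)]" by (rule card_length)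
    finally show "card {(v, u). {v, u} = e} \<le> 2" by (simp only: list.size numeral_2_eq_2)
  qed
  also have "\<dots> = 2 * card ?EW" by simp
  finally have "4 * card W \<le> 2 * card ?EW" .
  moreover have "card ?EW + 2 \<le> 2 * card W" by (rule triangle_free_sparse[OF _ W]) (rule tf)
  ultimately show False by linarith
qed

end

section \<open>The unit bar visibility number\<close>

lemma planar_plane_graph:
  assumes "pair_graph G" "planar G"
  obtains \<phi> \<Gamma> where "plane_graph (pverts G) {{u, v} | u v. (u, v) \<in> parcs G} \<phi> \<Gamma>"
proof -
  interpret G: pair_graph G by fact
  from assms(2) show thesis unfolding planar_def
  proof (elim exE)
    fix \<phi> :: "'a \<Rightarrow> complex" and \<gamma> :: "'a set \<Rightarrow> real \<Rightarrow> complex"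
    assume drawing: "inj_on \<phi> (pverts G) \<and>
        (\<forall>(u, v) \<in> parcs G. arc (\<gamma> {u, v}) \<and>
          {pathstart (\<gamma> {u, v}), pathfinish (\<gamma> {u, v})} = {\<phi> u, \<phi> v} \<and>
          path_image (\<gamma> {u, v}) \<inter> \<phi> ` pverts G = {\<phi> u, \<phi> v}) \<and>
        (\<forall>(u, v) \<in> parcs G. \<forall>(x, y) \<in> parcs G. {u, v} \<noteq> {x, y} \<longrightarrow>
          path_image (\<gamma> {u, v}) \<inter> path_image (\<gamma> {x, y}) \<subseteq> \<phi> ` pverts G)"
    have edge: "arc (\<gamma> {u, v}) \<and> {pathstart (\<gamma> {u, v}), pathfinish (\<gamma> {u, v})} = {\<phi> u, \<phi> v} \<and>
        path_image (\<gamma> {u, v}) \<inter> \<phi> ` pverts G = {\<phi> u, \<phi> v}" if "(u, v) \<in> parcs G" for u v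
      using bspec[OF conjunct1[OF conjunct2[OF drawing]] that] by (simp only: prod.case)
    have meet: "path_image (\<gamma> {u, v}) \<inter> path_image (\<gamma> {x, y}) \<subseteq> \<phi> ` pverts G"
      if uv: "(u, v) \<in> parcs G" and xy: "(x, y) \<in> parcs G" and ne: "{u, v} \<noteq> {x, y}" for u v x y
      using bspec[OF bspec[OF conjunct2[OF conjunct2[OF drawing]] uv, unfolded prod.case] xy, unfolded prod.case]
        ne by (rule mp)
    have "plane_graph (pverts G) {{u, v} | u v. (u, v) \<in> parcs G} \<phi> (\<lambda>e. path_image (\<gamma> e))"
    proof
      show "finite (pverts G)" by (rule G.pair_finite_verts)
      show "inj_on \<phi> (pverts G)" using drawing by (rule conjunct1)
      show "\<exists>u\<in>pverts G. \<exists>v\<in>pverts G. u \<noteq> v \<and> e = {u, v}" if e: "e \<in> {{u, v} | u v. (u, v) \<in> parcs G}" for e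
      proof -
        obtain u v where "e = {u, v}" "(u, v) \<in> parcs G" using e by blast
        then show ?thesis using G.in_arcsD1[of u v] G.in_arcsD2[of u v] G.pair_no_loops[of "(u, v)"] by auto
      qed
      show "\<exists>g. arc g \<and> path_image g = path_image (\<gamma> {u, v}) \<and> pathstart g = \<phi> u \<and> pathfinish g = \<phi> v"
        if uv: "{u, v} \<in> {{u, v} | u v. (u, v) \<in> parcs G}" for u v
      proof -
        obtain x y where xy: "{u, v} = {x, y}" "(x, y) \<in> parcs G" using uv by blast
        have "{\<phi> u, \<phi> v} = {\<phi> x, \<phi> y}" using arg_cong[OF xy(1), of "image \<phi>"] by simp
        then have g: "arc (\<gamma> {u, v})" "{pathstart (\<gamma> {u, v}), pathfinish (\<gamma> {u, v})} = {\<phi> u, \<phi> v}"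
          using edge[OF xy(2)] unfolding xy(1) by simp_all
        then consider "pathstart (\<gamma> {u, v}) = \<phi> u" "pathfinish (\<gamma> {u, v}) = \<phi> v"
          | "pathstart (\<gamma> {u, v}) = \<phi> v" "pathfinish (\<gamma> {u, v}) = \<phi> u"
          by (auto simp: doubleton_eq_iff)
        then show ?thesis
        proof cases
          case 1
          then show ?thesis using g by blast
        next
          case 2
          \<comment> \<open>The curve chosen for the unordered pair may run the other way.\<close>
          then show ?thesis using g arc_reversepath
            by (intro exI[of _ "reversepath (\<gamma> {u, v})"]) auto
        qed
      qed
      show "path_image (\<gamma> e) \<inter> \<phi> ` pverts G = \<phi> ` e" if e: "e \<in> {{u, v} | u v. (u, v) \<in> parcs G}" for e
      proof -
        obtain u v where "e = {u, v}" "(u, v) \<in> parcs G" using e by blast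
        then show ?thesis using edge[of u v] by simp
      qed
      show "path_image (\<gamma> e) \<inter> path_image (\<gamma> f) \<subseteq> \<phi> ` pverts G"
        if e: "e \<in> {{u, v} | u v. (u, v) \<in> parcs G}" and f: "f \<in> {{u, v} | u v. (u, v) \<in> parcs G}"
          and ne: "e \<noteq> f" for e f
      proof -
        obtain u v where "e = {u, v}" "(u, v) \<in> parcs G" using e by blast
        moreover obtain x y where "f = {x, y}" "(x, y) \<in> parcs G" using f by blast
        ultimately show ?thesis using meet[of u v x y] ne by simp
      qed
    qed
    then show thesis by (rule that)
  qed
qed

lemma girth_triangle:
  assumes "pair_graph G" "3 < girth G"
    and "(a, b) \<in> parcs G" "(b, c) \<in> parcs G" "(c, a) \<in> parcs G"
  shows False
proof -
  interpret pair_graph G by fact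
  let ?p = "[(a, b), (b, c), (c, a)]"
  have "awalk a ?p a" using assms in_arcsD1 by (auto simp: awalk_def)
  moreover have "distinct (tl (pawalk_verts a ?p))" using assms pair_no_loops by fastforce
  ultimately have "cycle ?p" unfolding cycle_def by blast
  then have "enat (length ?p) \<in> {enat (length p) | p. cycle p \<and> 3 \<le> length p}"
    by (intro CollectI exI[of _ ?p]) simp
  then have "girth G \<le> enat (length ?p)" unfolding girth_def by (rule Inf_lower)
  then show False using assms(2) by (simp add: numeral_eq_enat numeral_3_eq_3)
qed

lemma degree_le_max_degree:
  assumes "pair_graph G" "v \<in> pverts G"
  shows "card {u. (v, u) \<in> parcs G} \<le> max_degree G"
proof -
  interpret pair_graph G by fact
  have "out_arcs G v = {v} \<times> {u. (v, u) \<in> parcs G}"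
    by (auto simp: out_arcs_def)
  then have "card {u. (v, u) \<in> parcs G} = out_degree G v"
    by (simp add: out_degree_def card_cartesian_product)
  also have "\<dots> \<le> max_degree G" unfolding max_degree_def
    using assms(2) by (intro Max_ge) auto
  finally show ?thesis .
qed

lemma unit_bar_representation_exists:
  assumes G: "pair_graph G"
    and ok: "oriented_key_forest (\<lambda>u v. (u, v) \<in> parcs G) (pverts G) A K L"
  shows "\<exists>B. unit_bar_representation (max_degree G div 3 + 2) G B"
proof -
  interpret pair_graph G by fact
  have kf: "key_forest A K L" and A: "A \<subseteq> pverts G \<times> pverts G"
    and outs3: "\<And>v. card (outs A v) \<le> 3"
    and asym: "\<And>u v. (u, v) \<in> A \<Longrightarrow> (v, u) \<notin> A"
    and arcs: "\<And>u v. u \<in> pverts G \<Longrightarrow> v \<in> pverts G \<Longrightarrow> (u, v) \<in> parcs G \<longleftrightarrow> (u, v) \<in> A \<or> (v, u) \<in> A"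
    using ok unfolding oriented_key_forest_def by blast+
  let ?V = "pverts G"
  have K: "finite K" "\<And>k. k \<in> K \<Longrightarrow> valid_key k" "\<And>k. k \<in> K \<Longrightarrow> parent k \<in> K"
    and bij: "bij_betw (\<lambda>k. (L k, L (parent k))) {k \<in> K. 0 < depth k} A"
    and cen: "\<And>w. centres K L w \<noteq> {} \<Longrightarrow> 3 * card (centres K L w) + card (outs A w) \<le> card (ins A w) + 2"
    using kf by (auto simp: key_forest_def)
  have finA: "finite A" using kf key_forest_finite by blast
  have fin: "finite (outs A v)" "finite (ins A v)" for v using finite_outs_ins[OF finA] by auto
  have cen_pos: "0 < card (centres K L v)" if "centres K L v \<noteq> {}" for v
    using that K(1) by (simp add: card_gt_0_iff centres_def)
  have arcD: "(L k, L (parent k)) \<in> A" if "k \<in> K" "0 < depth k" for k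
    using bij_betwE[OF bij] that by blast
  have LV: "L k \<in> ?V" if k: "k \<in> K" for k
  proof (cases "depth k")
    case 0
    then have "k \<in> centres K L (L k)" using k by (simp add: centres_def)
    then have c: "centres K L (L k) \<noteq> {}" by blast
    \<comment> \<open>The invariant gives a vertex with a centre at least one in-edge, so no centre
      carries a label outside the graph.\<close>
    then have "0 < card (ins A (L k))" using cen[OF c] cen_pos[OF c] by linarith
    then obtain u where "(u, L k) \<in> A" by (auto simp: card_gt_0_iff)
    then show ?thesis using A by blast
  qed (use arcD[OF k] A in auto)
  define B where "B v = key_bar ` {k \<in> K. L k = v}" for v
  have UB: "(\<Union>w\<in>?V. B w) = key_bar ` K" using LV by (auto simp: B_def)
  have card_B: "card (B v) \<le> max_degree G div 3 + 2" if v: "v \<in> ?V" for v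
  proof -
    let ?o = "card (outs A v)" and ?i = "card (ins A v)" and ?c = "card (centres K L v)"
    have "{k \<in> K. L k = v} = {k \<in> K. 0 < depth k \<and> L k = v} \<union> centres K L v"
      by (auto simp: centres_def)
    then have "card {k \<in> K. L k = v} \<le> ?o + ?c"
      by (simp only: card_out_keys[OF kf, symmetric] card_Un_le)
    moreover have "card (B v) \<le> card {k \<in> K. L k = v}"
      unfolding B_def using K(1) by (intro card_image_le) simp
    moreover have "?o + ?i \<le> max_degree G"
    proof -
      have "outs A v \<union> ins A v = {u. (v, u) \<in> parcs G}"
        using arcs A v in_arcsD2 by blast
      moreover have "outs A v \<inter> ins A v = {}" using asym by blast
      ultimately have "?o + ?i = card {u. (v, u) \<in> parcs G}"
        using fin by (metis card_Un_disjoint)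
      then show ?thesis using degree_le_max_degree[OF G v] by simp
    qed
    moreover have "?c = 0 \<or> 3 * ?c + ?o \<le> ?i + 2" using cen[of v] by (cases "centres K L v = {}") auto
    moreover have "max_degree G < 3 * (max_degree G div 3) + 3"
      using dividend_less_div_times[of 3 "max_degree G"] by simp
    ultimately show ?thesis using outs3[of v] by linarith
  qed
  have adj: "(u, v) \<in> parcs G \<longleftrightarrow> (\<exists>S\<in>B u. \<exists>T\<in>B v. sees (\<Union>w\<in>?V. B w) S T)"
    if u: "u \<in> ?V" and v: "v \<in> ?V" for u v
  proof
    have "\<exists>S\<in>B u. \<exists>T\<in>B v. sees (key_bar ` K) S T" if uvA: "(u, v) \<in> A" for u v
    proof -
      have "(u, v) \<in> (\<lambda>k. (L k, L (parent k))) ` {k \<in> K. 0 < depth k}"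
        using uvA bij_betw_imp_surj_on[OF bij] by simp
      then obtain k where k: "k \<in> K" "0 < depth k" "L k = u" "L (parent k) = v" by blast
      have "key_bar k \<in> B u" "key_bar (parent k) \<in> B v" using k K(3) unfolding B_def by blast+
      then show ?thesis using sees_parent[OF K(2)[OF k(1)] k(2)] by blast
    qed
    then have "\<exists>S\<in>B u. \<exists>T\<in>B v. sees (key_bar ` K) S T" if "(u, v) \<in> A \<or> (v, u) \<in> A"
      using that sees_sym by blast
    moreover assume "(u, v) \<in> parcs G"
    ultimately show "\<exists>S\<in>B u. \<exists>T\<in>B v. sees (\<Union>w\<in>?V. B w) S T"
      unfolding UB using arcs[OF u v] by blast
  next
    assume "\<exists>S\<in>B u. \<exists>T\<in>B v. sees (\<Union>w\<in>?V. B w) S T"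
    then obtain S T where ST: "S \<in> B u" "T \<in> B v" "sees (key_bar ` K) S T"
      unfolding UB by (elim bexE)
    obtain k where k: "k \<in> K" "L k = u" "S = key_bar k" using ST(1) unfolding B_def by blast
    obtain l where l: "l \<in> K" "L l = v" "T = key_bar l" using ST(2) unfolding B_def by blast
    have kl: "sees (key_bar ` K) (key_bar k) (key_bar l)" "sees (key_bar ` K) (key_bar l) (key_bar k)"
      using ST(3) k(3) l(3) sees_sym by simp_all
    note KK = conjI[OF K(2,3)]
    show "(u, v) \<in> parcs G"
    proof (cases "depth k \<le> depth l")
      case True
      have "0 < depth l \<and> parent l = k"
        by (rule sees_imp_parent[OF KK k(1) l(1) kl(1) True])
      then show ?thesis using arcD[of l] k l arcs[OF u v] by simp
    next
      case False
      then have le: "depth l \<le> depth k" by linarith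
      have "0 < depth k \<and> parent k = l"
        by (rule sees_imp_parent[OF KK l(1) k(1) kl(2) le])
      then show ?thesis using arcD[of k] k l arcs[OF u v] by simp
    qed
  qed
  have disj: "S \<inter> T = {}" if ST: "S \<in> B u" "T \<in> B v" "(u, S) \<noteq> (v, T)" for u v S T
  proof -
    obtain k where k: "k \<in> K" "L k = u" "S = key_bar k" using ST(1) unfolding B_def by blast
    obtain l where l: "l \<in> K" "L l = v" "T = key_bar l" using ST(2) unfolding B_def by blast
    show ?thesis unfolding k(3) l(3)
      by (rule key_bar_disjoint[OF K(2)[OF k(1)] K(2)[OF l(1)]]) (use k l ST(3) in auto)
  qed
  have bars: "bar S" if "S \<in> B v" for S v using that bar_key_bar by (auto simp: B_def)
  have finB: "finite (B v)" for v using K(1) by (simp add: B_def)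
  have "unit_bar_representation (max_degree G div 3 + 2) G B"
    unfolding unit_bar_representation_def
  proof (intro conjI ballI impI)
    fix u v S T assume "u \<in> ?V" "v \<in> ?V" "S \<in> B u" "T \<in> B v" "(u, S) \<noteq> (v, T)"
    then show "S \<inter> T = {}" by (intro disj)
  qed (rule finB card_B bars adj; assumption)+
  then show ?thesis by blast
qed

theorem theorem12:
  fixes G :: "'a pair_pre_digraph"
  assumes "pair_graph G"
    and "planar G"
    and "girth G \<ge> 7"
  shows "int (ub G) \<le> \<lceil>(real (max_degree G) + 1) / 3\<rceil> + 1"
proof -
  interpret pair_graph G by fact
  let ?E = "{{u, v} | u v. (u, v) \<in> parcs G}"
  obtain \<phi> \<Gamma> where plane: "plane_graph (pverts G) ?E \<phi> \<Gamma>"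
    using planar_plane_graph assms(1,2) .
  have edge: "{u, v} \<in> ?E \<longleftrightarrow> (u, v) \<in> parcs G" for u v
    using arcs_symmetric by (auto simp: doubleton_eq_iff)
  have "3 < girth G" using assms(3) by (rule less_le_trans[rotated]) simp
  then have "False" if "{a, b} \<in> ?E" "{b, c} \<in> ?E" "{c, a} \<in> ?E" for a b c
    using girth_triangle[OF assms(1)] that unfolding edge by blast
  then have "\<exists>v\<in>X. card {u \<in> X. (v, u) \<in> parcs G} \<le> 3" if "X \<subseteq> pverts G" "X \<noteq> {}" for X
    using plane_graph.triangle_free_degenerate[OF plane _ that] unfolding edge by blast
  then obtain A K L where "oriented_key_forest (\<lambda>u v. (u, v) \<in> parcs G) (pverts G) A K L"
    using oriented_key_forest_exists[of "pverts G" "\<lambda>u v. (u, v) \<in> parcs G"]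
      arcs_symmetric pair_no_loops pair_finite_verts by fastforce
  then have "\<exists>B. unit_bar_representation (max_degree G div 3 + 2) G B"
    by (rule unit_bar_representation_exists[OF assms(1)])
  then obtain B where "unit_bar_representation (max_degree G div 3 + 2) G B"
    by blast
  then have "ub G \<le> max_degree G div 3 + 2" unfolding ub_def by (intro Least_le) blast
  moreover have "3 * (max_degree G div 3) \<le> max_degree G" by simp
  then have "real (3 * (max_degree G div 3)) \<le> real (max_degree G)" by (simp only: of_nat_le_iff)
  \<comment> \<open>The strict inequality \<Delta> div 3 < (\<Delta> + 1) / 3 lets the ceiling
    absorb one of the two additional bars.\<close>
  then have "int (max_degree G div 3) < \<lceil>(real (max_degree G) + 1) / 3\<rceil>"
    unfolding less_ceiling_iff by simp
  ultimately show ?thesis by linarith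
qed

end
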